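(* Let $\mathbb F$ be a field of characteristic $p>n$ or $p=0$. Let $0<t\le k\le n$, let $\ell$ be a non-negative integer, and let $B$ be a family of $k$-faces of $\mathcal H^n$. Put $f:=\sum_{x\in B}x\in M^n_k$ and let $f_{k,j,i}\in E_{k,j,i}$ be the spectral components of $f$. Then $B$ is a $(t,k,\ell)$-design on $\mathcal H^n$ if and only if (a) $f_{k,0,0}=\dfrac{\ell}{2^{k-t}\binom{n-t}{k-t}}\,l_k$, where $l_k=\sum_{x\in L^n_k}x$; and (b) $f_{k,j,i}=0$ for all $(j,i)\ne(0,0)$ with $0\le j\le t$ and $0\le i\le\min\{t-j,n-k\}$.
   Context: Let $V=\{\alpha_1,\bar\alpha_1,\dots,\alpha_n,\bar\alpha_n\}$ be a set of $2n$ distinct elements, with $\bar{\bar\alpha}_i=\alpha_i$. For $0\le k\le n$, $L^n_k$ is the set of $k$-element subsets $x\subseteq V$ with $|x\cap\{\alpha_i,\bar\alpha_i\}|\le1$ for all $i$ (the $k$-faces of the hyperoctahedron $\mathcal H^n$); $M^n_k$ is the $\mathbb F$-vector space with basis $L^n_k$ ($M^n_k=0$ if $k<0$ or $k>n$). Elements are written as polynomials in the vertices: a product of distinct vertices forming such a set denotes that set, extended bilinearly. Linear maps on $x\in L^n_k$: $\epsilon_k(x)=\sum_{y\in L^n_{k+1},\,y\supset x}y$, $\partial_k(x)=\sum_{z\in L^n_{k-1},\,z\subset x}z$, $\nu^+_k=\partial_{k+1}\epsilon_k$. Let $\dot V=\{\alpha_1,\dots,\alpha_n\}$; for disjoint $a,b\subseteq\dot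 V$, $[a,b]=\prod_{\alpha\in a}(\alpha+\bar\alpha)\prod_{\beta\in b}(\beta-\bar\beta)$, $[\emptyset,\emptyset]=\emptyset$. $E_{k,j}$ is the span of all $[a,b]$ with $a,b$ disjoint, $|a|=k-j$, $|b|=j$; it is $\nu^+_k$-invariant, and $E_{k,j,i}$ is the eigenspace of $\nu^+_k|_{E_{k,j}}$ for the eigenvalue $2(k-j+1-i)(n-k-i)$. For such $\mathbb F$ one has $M^n_k=\bigoplus_{j=0}^k\bigoplus_{i=0}^{\min\{k-j,n-k\}}E_{k,j,i}$, and the spectral components $f_{k,j,i}$ of $f\in M^n_k$ are the unique $f_{k,j,i}\in E_{k,j,i}$ with $f=\sum_{j,i}f_{k,j,i}$. A $(t,k,\ell)$-design on $\mathcal H^n$ is a set $B\subseteq L^n_k$ such that every $x\in L^n_t$ is contained in exactly $\ell$ members of $B$.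
   Formalization: For p>0 the "if" direction with exact counts is claimed only when p>ℓ and p>2^{k-t}·binom(n-t,k-t); otherwise (a),(b) are shown equivalent to containment counts congruent to ℓ mod p. The case p=2 (n=1), where the spectral components are undefined, is excluded. *)

theory Defs
  imports Complex_Main "HOL-Library.Function_Algebras" "HOL-Number_Theory.Cong"
begin

text \<open>The vertex \<open>\<alpha>\<^sub>i\<close> is \<open>(i, True)\<close> and its antipode is \<open>(i, False)\<close>, for \<open>1 \<le> i \<le> n\<close>.\<close>

type_synonym vertex = "nat \<times> bool"

definition verts :: "nat \<Rightarrow> vertex set" where
  "verts n = {1..n} \<times> UNIV"

definition bar :: "vertex \<Rightarrow> vertex" where
  "bar v = (fst v, \<not> snd v)"

definition pos_verts :: "nat \<Rightarrow> vertex set" where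
  "pos_verts n = {1..n} \<times> {True}"

definition faces :: "nat \<Rightarrow> nat \<Rightarrow> vertex set set" where
  "faces n k = {x. x \<subseteq> verts n \<and> card x = k \<and> (\<forall>v\<in>verts n. card (x \<inter> {v, bar v}) \<le> 1)}"

text \<open>
  Formal linear combinations of sets of vertices are coefficient functions \<open>vertex set \<Rightarrow> 'a\<close>
  with pointwise addition; \<open>M\<^sup>n\<^sub>k\<close> consists of those vanishing outside \<^term>\<open>faces n k\<close>.
\<close>

definition scale :: "'a::field \<Rightarrow> (vertex set \<Rightarrow> 'a) \<Rightarrow> vertex set \<Rightarrow> 'a" where
  "scale c f = (\<lambda>x. c * f x)"

definition basis :: "vertex set \<Rightarrow> vertex set \<Rightarrow> 'a::field" where
  "basis x = (\<lambda>y. if y = x then 1 else 0)"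

global_interpretation fvs: vector_space "scale :: 'a::field \<Rightarrow> _"
  by unfold_locales (auto simp: scale_def fun_eq_iff algebra_simps)

definition eps :: "nat \<Rightarrow> nat \<Rightarrow> (vertex set \<Rightarrow> 'a::field) \<Rightarrow> vertex set \<Rightarrow> 'a" where
  "eps n k f = (\<Sum>x\<in>faces n k. scale (f x) (\<Sum>y | y \<in> faces n (k + 1) \<and> x \<subset> y. basis y))"

text \<open>For \<open>k = 0\<close> the inner sum is empty, so truncated subtraction is harmless.\<close>

definition bd :: "nat \<Rightarrow> nat \<Rightarrow> (vertex set \<Rightarrow> 'a::field) \<Rightarrow> vertex set \<Rightarrow> 'a" where
  "bd n k f = (\<Sum>x\<in>faces n k. scale (f x) (\<Sum>z | z \<in> faces n (k - 1) \<and> z \<subset> x. basis z))"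

definition nu_plus :: "nat \<Rightarrow> nat \<Rightarrow> (vertex set \<Rightarrow> 'a::field) \<Rightarrow> vertex set \<Rightarrow> 'a" where
  "nu_plus n k = bd n (k + 1) \<circ> eps n k"

text \<open>
  Polynomial multiplication: the bilinear product sending a pair of disjoint sets \<open>y\<close>, \<open>z\<close> of
  vertices to \<open>y \<union> z\<close>.  (Pairs that are not disjoint contribute nothing; they do not occur in
  the products \<open>[a,b]\<close> below.)
\<close>

definition pmul :: "(vertex set \<Rightarrow> 'a::field) \<Rightarrow> (vertex set \<Rightarrow> 'a) \<Rightarrow> vertex set \<Rightarrow> 'a" where
  "pmul f g = (\<lambda>x. \<Sum>y\<in>Pow x. f y * g (x - y))"

lemma pmul_basis:
  assumes "finite y" "finite z" "y \<inter> z = {}"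
  shows "pmul (basis y) (basis z) = (basis (y \<union> z) :: vertex set \<Rightarrow> 'a::field)"
proof
  fix x :: "vertex set"
  show "pmul (basis y) (basis z) x = (basis (y \<union> z) x :: 'a)"
  proof (cases "finite x \<and> y \<subseteq> x")
    case True
    have "pmul (basis y) (basis z) x = (\<Sum>w\<in>Pow x. if w = y then basis z (x - y) else (0::'a))"
      unfolding pmul_def by (rule sum.cong) (auto simp: basis_def)
    also have "\<dots> = basis z (x - y)"
      using True by simp
    also have "\<dots> = basis (y \<union> z) x"
      using True assms(3) by (auto simp: basis_def)
    finally show ?thesis .
  next
    case False
    then have "x \<noteq> y \<union> z" using assms by auto
    moreover have "(\<Sum>w\<in>Pow x. basis y w * basis z (x - w)) = (0::'a)"
    proof (cases "finite x")
      case True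
      with False have "\<not> y \<subseteq> x" by simp
      then show ?thesis by (intro sum.neutral) (auto simp: basis_def)
    qed simp
    ultimately show ?thesis by (simp add: pmul_def basis_def)
  qed
qed

lemma pmul_left_commute: "pmul f (pmul g h) = pmul g (pmul f h)"
proof
  fix x :: "vertex set"
  have *: "pmul f (pmul g h) x =
      (\<Sum>(y, z)\<in>(SIGMA y:Pow x. Pow (x - y)). f y * (g z * h (x - y - z)))"
    if "finite x" for f g h :: "vertex set \<Rightarrow> 'a"
    using that by (simp add: pmul_def sum_distrib_left sum.Sigma)
  show "pmul f (pmul g h) x = pmul g (pmul f h) x"
  proof (cases "finite x")
    case True
    show ?thesis unfolding *[OF True]
      by (rule sum.reindex_bij_witness[of _ prod.swap prod.swap])
         (auto simp: Diff_eq Int_ac mult_ac)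
  qed (simp add: pmul_def)
qed

text \<open>
  For finite \<open>A\<close>, \<^term>\<open>pprod u A g\<close> is \<open>g\<close> multiplied by all \<open>u v\<close> with \<open>v \<in> A\<close>; the factors
  commute, so the order is immaterial.
\<close>

definition pprod ::
  "(vertex \<Rightarrow> vertex set \<Rightarrow> 'a::field) \<Rightarrow> vertex set \<Rightarrow> (vertex set \<Rightarrow> 'a) \<Rightarrow> vertex set \<Rightarrow> 'a" where
  "pprod u A g = Finite_Set.fold (\<lambda>v. pmul (u v)) g A"

lemma pprod_empty [simp]: "pprod u {} g = g"
  by (simp add: pprod_def)

lemma pprod_insert [simp]:
  assumes "finite A" "v \<notin> A"
  shows "pprod u (insert v A) g = pmul (u v) (pprod u A g)"
proof -
  interpret comp_fun_commute "\<lambda>v. pmul (u v)"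
    by unfold_locales (auto simp: fun_eq_iff pmul_left_commute)
  show ?thesis using assms by (simp add: pprod_def)
qed

definition bracket :: "vertex set \<Rightarrow> vertex set \<Rightarrow> vertex set \<Rightarrow> 'a::field" where
  "bracket a b = pprod (\<lambda>v. basis {v} + basis {bar v}) a
                  (pprod (\<lambda>v. basis {v} - basis {bar v}) b (basis {}))"

definition Ekj :: "nat \<Rightarrow> nat \<Rightarrow> nat \<Rightarrow> (vertex set \<Rightarrow> 'a::field) set" where
  "Ekj n k j = fvs.span {bracket a b | a b. a \<subseteq> pos_verts n \<and> b \<subseteq> pos_verts n \<and> a \<inter> b = {} \<and>
                           card a + j = k \<and> card b = j}"

definition Ekji :: "nat \<Rightarrow> nat \<Rightarrow> nat \<Rightarrow> nat \<Rightarrow> (vertex set \<Rightarrow> 'a::field) set" where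
  "Ekji n k j i = {g \<in> Ekj n k j.
     nu_plus n k g = scale (of_int (2 * (int k - int j + 1 - int i) * (int n - int k - int i))) g}"

text \<open>
  The family \<open>(j, i) \<mapsto> f\<^bsub>k,j,i\<^esub>\<close>.  Setting it to \<open>0\<close> outside the index range of the
  decomposition makes the function itself unique.
\<close>

definition spectral_components ::
  "nat \<Rightarrow> nat \<Rightarrow> (vertex set \<Rightarrow> 'a::field) \<Rightarrow> nat \<Rightarrow> nat \<Rightarrow> vertex set \<Rightarrow> 'a" where
  "spectral_components n k f = (THE c.
     (\<forall>j i. if j \<le> k \<and> i \<le> min (k - j) (n - k) then c j i \<in> Ekji n k j i else c j i = 0) \<and>
     f = (\<Sum>j\<le>k. \<Sum>i\<le>min (k - j) (n - k). c j i))"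

definition is_design :: "nat \<Rightarrow> nat \<Rightarrow> nat \<Rightarrow> nat \<Rightarrow> vertex set set \<Rightarrow> bool" where
  "is_design n t k l B \<longleftrightarrow> B \<subseteq> faces n k \<and> (\<forall>x\<in>faces n t. card {y \<in> B. x \<subseteq> y} = l)"

text \<open>
  Designs with multiplicities counted modulo \<open>p\<close>; congruence modulo \<open>0\<close> is equality, so for
  \<open>p = 0\<close> these are the designs above.
\<close>

definition is_design_mod :: "nat \<Rightarrow> nat \<Rightarrow> nat \<Rightarrow> nat \<Rightarrow> nat \<Rightarrow> vertex set set \<Rightarrow> bool" where
  "is_design_mod p n t k l B \<longleftrightarrow>
     B \<subseteq> faces n k \<and> (\<forall>x\<in>faces n t. [card {y \<in> B. x \<subseteq> y} = l] (mod p))"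

lemma is_design_mod_0: "is_design_mod 0 n t k l B \<longleftrightarrow> is_design n t k l B"
  by (simp add: is_design_mod_def is_design_def)

end

theory Submission
  imports Defs
begin

text \<open>
  Let \<open>\<tau>\<close> be the operator sending a face to the sum of the faces obtained by replacing one of its
  vertices by the antipode.  The factors \<open>\<alpha> + bar \<alpha>\<close> and \<open>\<beta> - bar \<beta>\<close> are eigenvectors of flipping a
  single vertex, so \<open>E\<^bsub>k,j\<^esub>\<close> is exactly the eigenspace of \<open>\<tau>\<close> on \<open>M\<^sub>k\<close> for \<open>k - 2 j\<close>.  Moreover
  \<open>\<partial> \<epsilon> - \<epsilon> \<partial> = 2 n - 3 k - \<tau>\<close> on \<open>M\<^sub>k\<close>, a scalar on each \<open>E\<^bsub>k,j\<^esub>\<close>.  This \<open>sl\<^sub>2\<close>-like relation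
  shows that \<open>\<partial>\<close> maps \<open>E\<^bsub>k+1,j,i\<^esub>\<close> to \<open>E\<^bsub>k,j,i\<^esub>\<close>, injectively for \<open>i \<le> k - j\<close>, since there \<open>\<epsilon> \<partial>\<close>
  acts as a nonzero scalar, and that it vanishes for \<open>i = k + 1 - j\<close>.

  Up to the invertible factor \<open>(k - t)!\<close>, \<open>\<partial>\<^bsup>k-t\<^esup>\<close> sends \<open>f\<close> to the function counting, for each \<open>t\<close>-face,
  the members of \<open>B\<close> above it.  Being a design modulo the characteristic therefore means that \<open>f\<close>
  minus the multiple of \<open>l\<^sub>k\<close> in (a) lies in the kernel of \<open>\<partial>\<^bsup>k-t\<^esup>\<close>, which is the sum of
  the \<open>E\<^bsub>k,j,i\<^esub>\<close> with \<open>i + j > t\<close>.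
\<close>

section \<open>Faces and operators\<close>

lemma fun_sum_apply: "(\<Sum>i\<in>I. g i) x = (\<Sum>i\<in>I. g i x)" for g :: "'i \<Rightarrow> 'b \<Rightarrow> 'c::comm_monoid_add"
  by (induction I rule: infinite_finite_induct) auto

lemma scale_apply [simp]: "scale c f x = c * f x"
  by (simp add: scale_def)

lemma bar_bar [simp]: "bar (bar v) = v"
  and bar_neq [simp]: "bar v \<noteq> v" "v \<noteq> bar v"
  and bar_eq_iff [simp]: "bar v = bar w \<longleftrightarrow> v = w"
  by (auto simp: bar_def prod_eq_iff)

lemma snd_bar [simp]: "snd (bar v) \<longleftrightarrow> \<not> snd v"
  by (simp add: bar_def)

lemma bar_in_verts [simp]: "bar v \<in> verts n \<longleftrightarrow> v \<in> verts n"
  by (cases v) (auto simp: bar_def verts_def)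

lemma finite_verts [simp]: "finite (verts n)"
  by (simp add: verts_def)

lemma card_verts: "card (verts n) = 2 * n"
  by (simp add: verts_def card_cartesian_product)

lemma faces_iff:
  "x \<in> faces n k \<longleftrightarrow> x \<subseteq> verts n \<and> card x = k \<and> (\<forall>v\<in>x. bar v \<notin> x)"
proof -
  have "card (x \<inter> {v, bar v}) \<le> 1 \<longleftrightarrow> \<not> (v \<in> x \<and> bar v \<in> x)" for v
    by (cases "v \<in> x"; cases "bar v \<in> x") simp_all
  then show ?thesis
    unfolding faces_def by auto
qed

lemma finite_faces [simp]: "finite (faces n k)"
  by (rule finite_subset[of _ "Pow (verts n)"]) (auto simp: faces_def)

lemma finite_face: "x \<in> faces n k \<Longrightarrow> finite x"
  using finite_subset[OF _ finite_verts] by (auto simp: faces_iff)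

section \<open>Faces under insertion, deletion and flipping of a vertex\<close>

definition free :: "nat \<Rightarrow> vertex set \<Rightarrow> vertex set" where
  "free n x = {v \<in> verts n. v \<notin> x \<and> bar v \<notin> x}"

definition flip :: "vertex \<Rightarrow> vertex set \<Rightarrow> vertex set" where
  "flip v x = insert (bar v) (x - {v})"

lemma finite_free [simp]: "finite (free n x)"
  by (simp add: free_def)

lemma free_not_in: "w \<in> free n x \<Longrightarrow> w \<notin> x"
  and bar_free_iff [simp]: "bar w \<in> free n x \<longleftrightarrow> w \<in> free n x"
  by (auto simp: free_def)

text \<open>\<open>verts n\<close> is the disjoint union of \<open>free n x\<close>,
  \<open>x\<close> and the antipodes of \<open>x\<close>. The additive form avoids truncated
  subtraction.\<close>

lemma card_free:
  assumes "x \<in> faces n k"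
  shows "card (free n x) + 2 * k = 2 * n" "k \<le> n"
proof -
  have fin: "finite x" and x: "x \<subseteq> verts n" "card x = k" "\<forall>v\<in>x. bar v \<notin> x"
    using assms finite_face by (auto simp: faces_iff)
  have "verts n = free n x \<union> (x \<union> bar ` x)"
    using x(1) by (auto simp: free_def image_iff) (metis bar_bar)
  moreover have "free n x \<inter> (x \<union> bar ` x) = {}"
    by (auto simp: free_def)
  ultimately have "card (verts n) = card (free n x) + card (x \<union> bar ` x)"
    using fin by (simp add: card_Un_disjoint)
  also have "card (x \<union> bar ` x) = card x + card (bar ` x)"
    using fin x(3) by (intro card_Un_disjoint) auto
  also have "card (bar ` x) = card x"
    by (intro card_image) (auto simp: inj_on_def)
  finally show "card (free n x) + 2 * k = 2 * n"
    using x(2) by (simp add: card_verts)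
  then show "k \<le> n" by simp
qed

lemma face_remove:
  "x \<in> faces n (Suc k) \<Longrightarrow> v \<in> x \<Longrightarrow> x - {v} \<in> faces n k"
  using finite_face[of x] by (auto simp: faces_iff)

lemma face_insert:
  "x \<in> faces n k \<Longrightarrow> w \<in> free n x \<Longrightarrow> insert w x \<in> faces n (Suc k)"
  using finite_face[of x] by (auto simp: faces_iff free_def dest: sym)

lemma face_flip:
  assumes "x \<in> faces n k" "v \<in> x" shows "flip v x \<in> faces n k"
proof -
  have "finite x" using assms finite_face by blast
  moreover have "bar v \<notin> x" using assms by (auto simp: faces_iff)
  moreover have "card x > 0" using assms \<open>finite x\<close> by (auto simp: card_gt_0_iff)
  ultimately show ?thesis using assms
    by (auto simp: faces_iff flip_def)
qed

lemma free_flip [simp]: "v \<in> x \<Longrightarrow> bar v \<notin> x \<Longrightarrow> free n (flip v x) = free n x"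
  by (auto simp: free_def flip_def)

section \<open>Coefficients of the coboundary and boundary maps\<close>

lemma sum_basis_apply:
  "finite S \<Longrightarrow> (\<Sum>y\<in>S. basis y x) = (if x \<in> S then 1 else (0::'a::field))"
  by (simp add: basis_def)

text \<open>The coefficient at \<open>y\<close> collects \<open>f\<close> over the faces covered by
  \<open>y\<close>, and \<open>v \<mapsto> y - {v}\<close> is a bijection from \<open>y\<close> onto
  them.\<close>

lemma eps_apply:
  "eps n k f y = (if y \<in> faces n (Suc k) then \<Sum>v\<in>y. f (y - {v}) else (0::'a::field))"
proof -
  have "eps n k f y = (\<Sum>x\<in>faces n k. if y \<in> faces n (Suc k) \<and> x \<subset> y then f x else 0)"
    by (auto simp: eps_def fun_sum_apply sum_basis_apply intro!: sum.cong)
  also have "\<dots> = (if y \<in> faces n (Suc k) then \<Sum>x\<in>{x \<in> faces n k. x \<subset> y}. f x else 0)"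
    by (simp add: sum.inter_filter)
  also have "\<dots> = (if y \<in> faces n (Suc k) then \<Sum>v\<in>y. f (y - {v}) else 0)"
  proof (cases "y \<in> faces n (Suc k)")
    case True
    then have fin: "finite y" and card: "card y = Suc k" using finite_face by (auto simp: faces_iff)
    have "{x \<in> faces n k. x \<subset> y} = (\<lambda>v. y - {v}) ` y"
    proof (intro equalityI subsetI)
      fix x assume "x \<in> {x \<in> faces n k. x \<subset> y}"
      then have x: "x \<subset> y" "card x = k" by (auto simp: faces_iff)
      then obtain v where v: "v \<in> y" "v \<notin> x" by blast
      then have "x \<subseteq> y - {v}" "card (y - {v}) = k" using x card fin by auto
      then have "x = y - {v}" using x fin by (intro card_subset_eq) auto
      then show "x \<in> (\<lambda>v. y - {v}) ` y" using v by blast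
    qed (use face_remove[OF True] in auto)
    moreover have "inj_on (\<lambda>v. y - {v}) y" by (auto simp: inj_on_def)
    ultimately show ?thesis using True by (simp add: sum.reindex)
  qed simp
  finally show ?thesis .
qed

text \<open>Dual to \<open>eps_apply\<close>: each face covering \<open>z\<close> arises from
  exactly one vertex of \<open>free n z\<close>.\<close>

lemma bd_apply:
  "bd n (Suc k) f z = (if z \<in> faces n k then \<Sum>w\<in>free n z. f (insert w z) else (0::'a::field))"
proof -
  have "bd n (Suc k) f z = (\<Sum>x\<in>faces n (Suc k). if z \<in> faces n k \<and> z \<subset> x then f x else 0)"
    by (auto simp: bd_def fun_sum_apply sum_basis_apply intro!: sum.cong)
  also have "\<dots> = (if z \<in> faces n k then \<Sum>x\<in>{x \<in> faces n (Suc k). z \<subset> x}. f x else 0)"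
    by (simp add: sum.inter_filter)
  also have "\<dots> = (if z \<in> faces n k then \<Sum>w\<in>free n z. f (insert w z) else 0)"
  proof (cases "z \<in> faces n k")
    case True
    then have fin: "finite z" and card: "card z = k" using finite_face by (auto simp: faces_iff)
    have "{x \<in> faces n (Suc k). z \<subset> x} = (\<lambda>w. insert w z) ` free n z"
    proof (intro equalityI subsetI)
      fix x assume "x \<in> {x \<in> faces n (Suc k). z \<subset> x}"
      then have x: "x \<in> faces n (Suc k)" "z \<subset> x" "card x = Suc k" by (auto simp: faces_iff)
      then obtain w where w: "w \<in> x" "w \<notin> z" by blast
      then have "insert w z \<subseteq> x" "card (insert w z) = card x" using x card fin by auto
      then have eq: "insert w z = x" using x(1) finite_face by (intro card_subset_eq) auto
      moreover have "w \<in> free n z" using w x by (auto simp: free_def faces_iff)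
      ultimately show "x \<in> (\<lambda>w. insert w z) ` free n z" by blast
    qed (use face_insert[OF True] in \<open>auto simp: free_def\<close>)
    moreover have "inj_on (\<lambda>w. insert w z) (free n z)"
      by (auto simp: inj_on_def free_def)
    ultimately show ?thesis using True by (simp add: sum.reindex)
  qed simp
  finally show ?thesis .
qed

text \<open>Since \<open>0 - 1 = 0\<close>, the inner sum ranges over 0-faces properly contained in
  the empty face, and there are none.\<close>

lemma bd_0 [simp]: "bd n 0 f = (0 :: _ \<Rightarrow> 'a::field)"
proof -
  have "{z. z \<in> faces n (0 - 1) \<and> z \<subset> x} = {}" if "x \<in> faces n 0" for x
    using that finite_face[OF that] by (auto simp: faces_iff)
  then have "bd n 0 f = (\<Sum>x\<in>faces n 0. scale (f x) (\<Sum>z\<in>{}. basis z))"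
    unfolding bd_def by (intro sum.cong refl arg_cong2[of _ _ _ _ scale] sum.cong)
  then show ?thesis by (simp add: fun_eq_iff fun_sum_apply)
qed

section \<open>The flip operator and its commutation relations\<close>

definition tau :: "nat \<Rightarrow> nat \<Rightarrow> (vertex set \<Rightarrow> 'a::field) \<Rightarrow> vertex set \<Rightarrow> 'a" where
  "tau n k f x = (if x \<in> faces n k then \<Sum>v\<in>x. f (flip v x) else 0)"

definition chain_space :: "nat \<Rightarrow> nat \<Rightarrow> (vertex set \<Rightarrow> 'a::field) set" where
  "chain_space n k = {f. \<forall>x. x \<notin> faces n k \<longrightarrow> f x = 0}"

lemma bd_in_chain_space: "bd n k f \<in> chain_space n (k - 1)"
  by (cases k) (auto simp: chain_space_def bd_apply)

lemma eps_in_chain_space: "eps n k f \<in> chain_space n (Suc k)"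
  by (auto simp: chain_space_def eps_apply)

text \<open>Both compositions sum \<open>f\<close> over exchanges of a vertex \<open>v\<close> of
  \<open>x\<close> for a vertex \<open>w\<close>. Those with \<open>w\<close> free for
  \<open>x\<close> are common to both (the sum \<open>S\<close>). Besides them, \<open>bd\<close>
  after \<open>eps\<close> returns to \<open>x\<close> in \<open>2 * (n - k)\<close> ways, whereas
  \<open>eps\<close> after \<open>bd\<close> returns to \<open>x\<close> in \<open>k\<close> ways
  and also exchanges \<open>v\<close> for \<open>bar v\<close>, which is \<open>tau\<close>.\<close>

lemma bd_eps:
  fixes f :: "vertex set \<Rightarrow> 'a::field"
  assumes f: "f \<in> chain_space n k"
  shows "bd n (Suc k) (eps n k f) =
         eps n (k - 1) (bd n k f) + scale (of_int (2 * int n - 3 * int k)) f - tau n k f"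
proof
  fix x
  show "bd n (Suc k) (eps n k f) x =
        (eps n (k - 1) (bd n k f) + scale (of_int (2 * int n - 3 * int k)) f - tau n k f) x"
  proof (cases "x \<in> faces n k")
    case False
    have "eps n (k - 1) (bd n k f) x = 0"
    proof (cases k)
      case (Suc k')
      then show ?thesis using False by (simp add: eps_apply)
    qed (simp add: eps_apply)
    then show ?thesis using False f by (simp add: bd_apply tau_def chain_space_def)
  next
    case True
    then have fin: "finite x" and k: "card x = k" and nb: "\<And>v. v \<in> x \<Longrightarrow> bar v \<notin> x"
      and x: "x \<subseteq> verts n"
      using finite_face by (auto simp: faces_iff)
    define S where "S = (\<Sum>v\<in>x. \<Sum>w\<in>free n x. f (insert w (x - {v})))"
    have "bd n (Suc k) (eps n k f) x =
        (\<Sum>w\<in>free n x. \<Sum>v\<in>insert w x. f (insert w x - {v}))"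
      using True by (simp add: bd_apply eps_apply face_insert)
    also have "\<dots> = (\<Sum>w\<in>free n x. f x + (\<Sum>v\<in>x. f (insert w (x - {v}))))"
    proof (rule sum.cong)
      fix w assume w: "w \<in> free n x"
      then have "w \<notin> x" by (rule free_not_in)
      then have "(\<Sum>v\<in>insert w x. f (insert w x - {v})) = f x + (\<Sum>v\<in>x. f (insert w x - {v}))"
        using fin by simp
      also have "(\<Sum>v\<in>x. f (insert w x - {v})) = (\<Sum>v\<in>x. f (insert w (x - {v})))"
        using \<open>w \<notin> x\<close> by (intro sum.cong refl arg_cong[of _ _ f]) auto
      finally show "(\<Sum>v\<in>insert w x. f (insert w x - {v})) =
        f x + (\<Sum>v\<in>x. f (insert w (x - {v})))" .
    qed simp
    also have "\<dots> = of_nat (card (free n x)) * f x + S"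
      by (simp add: sum.distrib S_def sum.swap[of _ x])
    also have "of_nat (card (free n x)) = (of_int (2 * int n - 2 * int k) :: 'a)"
    proof -
      have "int (card (free n x)) = 2 * int n - 2 * int k"
        using card_free(1)[OF True] by linarith
      then show ?thesis by (metis of_int_of_nat_eq)
    qed
    finally have 1: "bd n (Suc k) (eps n k f) x = of_int (2 * int n - 2 * int k) * f x + S" .
    have 2: "eps n (k - 1) (bd n k f) x = of_int (int k) * f x + tau n k f x + S"
    proof (cases k)
      case 0
      then show ?thesis using fin k by (simp add: eps_apply S_def tau_def)
    next
      case (Suc k')
      have "eps n (k - 1) (bd n k f) x =
          (\<Sum>v\<in>x. \<Sum>w\<in>free n (x - {v}). f (insert w (x - {v})))"
        using True Suc by (simp add: eps_apply bd_apply face_remove)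
      also have "\<dots> = (\<Sum>v\<in>x. f x + f (flip v x) + (\<Sum>w\<in>free n x. f (insert w (x - {v}))))"
      proof (rule sum.cong)
        fix v assume v: "v \<in> x"
        \<comment> \<open>Deleting \<open>v\<close> frees both \<open>v\<close> and
          \<open>bar v\<close>: inserting the first restores \<open>x\<close>, inserting the second
          gives \<open>flip v x\<close>.\<close>
        have "free n (x - {v}) = insert v (insert (bar v) (free n x))"
        proof (rule set_eqI)
          fix w
          have "bar w = v \<longleftrightarrow> w = bar v" by auto
          moreover have "v \<in> verts n" using v x by blast
          ultimately show "w \<in> free n (x - {v}) \<longleftrightarrow> w \<in> insert v (insert (bar v) (free n x))"
            using v nb[OF v] by (cases "w = v"; cases "w = bar v") (simp_all add: free_def)
        qed
        moreover have "v \<notin> insert (bar v) (free n x)" "bar v \<notin> free n x"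
          using v by (auto simp: free_def)
        ultimately show "(\<Sum>w\<in>free n (x - {v}). f (insert w (x - {v}))) =
            f x + f (flip v x) + (\<Sum>w\<in>free n x. f (insert w (x - {v})))"
          using v by (simp add: flip_def insert_absorb)
      qed simp
      also have "\<dots> = of_int (int k) * f x + tau n k f x + S"
        using True k by (simp add: sum.distrib S_def tau_def)
      finally show ?thesis .
    qed
    show ?thesis using 1 2 by (simp add: algebra_simps)
  qed
qed

text \<open>Flipping \<open>v\<close> commutes with deleting a vertex, unless the deleted vertex is
  the new \<open>bar v\<close>; that case leaves \<open>y - {v}\<close> and contributes the extra
  \<open>eps n k f\<close>.\<close>

lemma tau_eps:
  fixes f :: "vertex set \<Rightarrow> 'a::field"
  shows "tau n (Suc k) (eps n k f) = eps n k (tau n k f + f)"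
proof
  fix y
  show "tau n (Suc k) (eps n k f) y = eps n k (tau n k f + f) y"
  proof (cases "y \<in> faces n (Suc k)")
    case True
    then have fin: "finite y" and nb: "\<And>v. v \<in> y \<Longrightarrow> bar v \<notin> y"
      using finite_face by (auto simp: faces_iff)
    have "tau n (Suc k) (eps n k f) y = (\<Sum>v\<in>y. \<Sum>w\<in>flip v y. f (flip v y - {w}))"
      using True by (simp add: tau_def eps_apply face_flip)
    \<comment> \<open>The sum over \<open>w \<noteq> v\<close> is padded with zeros, so that its
      range does not depend on \<open>v\<close> and the order of summation can be exchanged.\<close>
    also have "\<dots> = (\<Sum>v\<in>y. f (y - {v}) + (\<Sum>w\<in>y. if w \<noteq> v then f (flip v (y - {w})) else 0))"
    proof (rule sum.cong)
      fix v assume v: "v \<in> y"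
      have "flip v y - {bar v} = y - {v}" using nb[OF v] by (auto simp: flip_def)
      moreover have "flip v y - {w} = flip v (y - {w})" if "w \<in> y - {v}" for w
        using that nb[OF v] by (auto simp: flip_def)
      ultimately have "(\<Sum>w\<in>flip v y. f (flip v y - {w})) =
          f (y - {v}) + (\<Sum>w\<in>y - {v}. f (flip v (y - {w})))"
        using fin nb[OF v] by (subst flip_def) simp
      also have "(\<Sum>w\<in>y - {v}. f (flip v (y - {w}))) =
          (\<Sum>w\<in>y. if w \<noteq> v then f (flip v (y - {w})) else 0)"
        using fin by (intro sum.mono_neutral_cong_left) auto
      finally show "(\<Sum>w\<in>flip v y. f (flip v y - {w})) =
          f (y - {v}) + (\<Sum>w\<in>y. if w \<noteq> v then f (flip v (y - {w})) else 0)" .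
    qed simp
    also have "\<dots> = (\<Sum>v\<in>y. f (y - {v})) +
        (\<Sum>w\<in>y. \<Sum>v\<in>y. if w \<noteq> v then f (flip v (y - {w})) else 0)"
      unfolding sum.distrib by (rule arg_cong2[of _ _ _ _ "(+)"], rule refl, rule sum.swap)
    also have "(\<Sum>w\<in>y. \<Sum>v\<in>y. if w \<noteq> v then f (flip v (y - {w})) else 0) =
        (\<Sum>w\<in>y. tau n k f (y - {w}))"
    proof (rule sum.cong)
      fix w assume w: "w \<in> y"
      have "(\<Sum>v\<in>y. if w \<noteq> v then f (flip v (y - {w})) else 0) =
          (\<Sum>v\<in>y - {w}. f (flip v (y - {w})))"
        using fin by (intro sum.mono_neutral_cong_right) auto
      then show "(\<Sum>v\<in>y. if w \<noteq> v then f (flip v (y - {w})) else 0) = tau n k f (y - {w})"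
        using True w by (simp add: tau_def face_remove)
    qed simp
    also have "(\<Sum>v\<in>y. f (y - {v})) + (\<Sum>w\<in>y. tau n k f (y - {w})) = eps n k (tau n k f + f) y"
      using True by (simp add: eps_apply sum.distrib add.commute)
    finally show ?thesis .
  qed (simp add: tau_def eps_apply)
qed

text \<open>Flipping an old vertex commutes with inserting \<open>w\<close>. Flipping
  \<open>w\<close> itself amounts to inserting \<open>bar w\<close>, and as \<open>bar\<close>
  permutes the free vertices these terms add up to \<open>bd n (Suc k) f\<close>.\<close>

lemma tau_bd:
  fixes f :: "vertex set \<Rightarrow> 'a::field"
  shows "tau n k (bd n (Suc k) f) = bd n (Suc k) (tau n (Suc k) f - f)"
proof
  fix z
  show "tau n k (bd n (Suc k) f) z = bd n (Suc k) (tau n (Suc k) f - f) z"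
  proof (cases "z \<in> faces n k")
    case True
    then have fin: "finite z" and nb: "\<And>v. v \<in> z \<Longrightarrow> bar v \<notin> z"
      using finite_face by (auto simp: faces_iff)
    have "bd n (Suc k) (tau n (Suc k) f) z =
        (\<Sum>w\<in>free n z. \<Sum>v\<in>insert w z. f (flip v (insert w z)))"
      using True by (simp add: tau_def bd_apply face_insert)
    also have "\<dots> = (\<Sum>w\<in>free n z. f (insert (bar w) z) + (\<Sum>v\<in>z. f (insert w (flip v z))))"
    proof (rule sum.cong)
      fix w assume w: "w \<in> free n z"
      then have "w \<notin> z" by (rule free_not_in)
      then have "flip w (insert w z) = insert (bar w) z" by (auto simp: flip_def)
      moreover have "flip v (insert w z) = insert w (flip v z)" if "v \<in> z" for v
        using that \<open>w \<notin> z\<close> by (auto simp: flip_def)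
      ultimately show "(\<Sum>v\<in>insert w z. f (flip v (insert w z))) =
          f (insert (bar w) z) + (\<Sum>v\<in>z. f (insert w (flip v z)))"
        using fin \<open>w \<notin> z\<close> by simp
    qed simp
    also have "\<dots> = (\<Sum>w\<in>free n z. f (insert (bar w) z)) +
        (\<Sum>v\<in>z. \<Sum>w\<in>free n z. f (insert w (flip v z)))"
      by (simp add: sum.distrib sum.swap[of _ z])
    also have "(\<Sum>w\<in>free n z. f (insert (bar w) z)) = bd n (Suc k) f z"
      using True by (simp add: bd_apply, intro sum.reindex_bij_witness[of _ bar bar]) auto
    also have "(\<Sum>v\<in>z. \<Sum>w\<in>free n z. f (insert w (flip v z))) = tau n k (bd n (Suc k) f) z"
      using True nb by (simp add: tau_def bd_apply face_flip)
    finally show ?thesis using True by (simp add: bd_apply sum_subtractf)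
  qed (simp add: tau_def bd_apply)
qed

section \<open>Brackets\<close>

lemma pmul_basis_single:
  "pmul (basis {v}) g x = (if finite x \<and> v \<in> x then g (x - {v}) else (0::'a::field))"
proof (cases "finite x")
  case True
  have "pmul (basis {v}) g x = (\<Sum>y\<in>Pow x. if y = {v} then g (x - {v}) else 0)"
    unfolding pmul_def by (rule sum.cong) (auto simp: basis_def)
  then show ?thesis using True by simp
qed (simp add: pmul_def)

lemma pmul_add_left: "pmul (f + g) h = pmul f h + pmul g h"
  by (simp add: pmul_def fun_eq_iff sum.distrib algebra_simps)

lemma pmul_diff_left: "pmul (f - g) h = pmul f h - pmul g h"
  by (simp add: pmul_def fun_eq_iff sum_subtractf algebra_simps)

lemma pmul_add_right: "pmul h (f + g) = pmul h f + pmul h g"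
  by (simp add: pmul_def fun_eq_iff sum.distrib algebra_simps)

lemma pmul_scale_right: "pmul h (scale c f) = scale c (pmul h f)"
  by (simp add: pmul_def fun_eq_iff sum_distrib_left algebra_simps)

lemma pprod_pmul:
  "finite A \<Longrightarrow> pprod u A (pmul h g) = pmul h (pprod u A g)"
  by (induction A rule: finite_induct) (simp_all add: pmul_left_commute)

text \<open>For a finite set \<open>A\<close> of positive vertices these are the monomials in the
  expansion of a product with one factor \<open>v + bar v\<close> or \<open>v - bar v\<close> for
  each \<open>v\<close> in \<open>A\<close>.\<close>

definition transversal :: "vertex set \<Rightarrow> vertex set \<Rightarrow> bool" where
  "transversal A x \<longleftrightarrow> x \<subseteq> A \<union> bar ` A \<and> (\<forall>v\<in>A. v \<in> x \<longleftrightarrow> bar v \<notin> x)"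

definition pos :: "vertex \<Rightarrow> vertex" where
  "pos v = (fst v, True)"

lemma pos_cases: "pos v = v \<or> pos v = bar v"
  by (cases v) (auto simp: pos_def bar_def)

lemma pos_bar [simp]: "pos (bar v) = pos v"
  by (simp add: pos_def bar_def)

lemma pos_eq_iff: "pos v = pos w \<longleftrightarrow> v = w \<or> v = bar w"
  by (cases v; cases w) (auto simp: pos_def bar_def)

lemma pos_id: "snd v \<Longrightarrow> pos v = v"
  by (cases v) (simp add: pos_def)

lemma transversal_insert:
  assumes "\<forall>w\<in>insert v A. snd w" "v \<notin> A"
  shows "transversal (insert v A) x \<longleftrightarrow>
    (if v \<in> x then bar v \<notin> x \<and> transversal A (x - {v})
     else bar v \<in> x \<and> transversal A (x - {bar v}))"
proof -
  have *: "bar w \<noteq> v" "w \<noteq> bar v" "w \<noteq> v" if "w \<in> A" for w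
  proof -
    have "snd w" "snd v" using assms(1) that by blast+
    then show "bar w \<noteq> v" "w \<noteq> bar v" using snd_bar by metis+
    show "w \<noteq> v" using that assms(2) by blast
  qed
  have U: "insert v A \<union> bar ` insert v A = insert v (insert (bar v) (A \<union> bar ` A))"
    by (simp add: insert_commute)
  have ball: "(\<forall>w\<in>A. w \<in> x - {v} \<longleftrightarrow> bar w \<notin> x - {v}) \<longleftrightarrow> (\<forall>w\<in>A. w \<in> x \<longleftrightarrow> bar w \<notin> x)"
    "(\<forall>w\<in>A. w \<in> x - {bar v} \<longleftrightarrow> bar w \<notin> x - {bar v}) \<longleftrightarrow> (\<forall>w\<in>A. w \<in> x \<longleftrightarrow> bar w \<notin> x)"
    using * by (intro ball_cong refl, simp)+
  show ?thesis
    unfolding transversal_def U ball subset_insert_iff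
    by (cases "v \<in> x"; cases "bar v \<in> x") simp_all
qed

text \<open>One induction step for both kinds of factors of a bracket: \<open>s = 1\<close> gives
  the plus sign, \<open>s = - 1\<close> the minus sign. The coefficient \<open>P\<close> collected
  so far must not depend on the new antipodal pair.\<close>

lemma pmul_transversal:
  fixes g :: "vertex set \<Rightarrow> 'a::field"
  assumes "\<forall>w\<in>insert v A. snd w" "v \<notin> A" "finite A"
    and g: "\<And>x. g x = (if transversal A x then P x else 0)"
    and P: "P (x - {v}) = P x" "P (x - {bar v}) = P x"
    and u: "u = basis {v} + scale s (basis {bar v})"
  shows "pmul u g x = (if transversal (insert v A) x then (if v \<in> x then 1 else s) * P x else 0)"
proof (cases "finite x")
  case True
  have sc: "pmul (scale s (basis {bar v})) g = scale s (pmul (basis {bar v}) g)"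
    by (simp add: pmul_def fun_eq_iff sum_distrib_left algebra_simps)
  \<comment> \<open>A set containing \<open>bar v\<close> is not covered by the pairs of
    \<open>A\<close>. With the symmetric statement below, at most one of the two summands of
    \<open>u\<close> contributes at \<open>x\<close>.\<close>
  have "\<not> transversal A (x - {v})" if "bar v \<in> x"
  proof
    assume "transversal A (x - {v})"
    then have "bar v \<in> A \<union> bar ` A" using that by (auto simp: transversal_def)
    then show False using assms(1,2) snd_bar[of v] by (metis UnE bar_bar image_iff insertCI)
  qed
  moreover have "\<not> transversal A (x - {bar v})" if "v \<in> x"
  proof
    assume "transversal A (x - {bar v})"
    then have "v \<in> A \<union> bar ` A" using that by (auto simp: transversal_def)
    then show False using assms(1,2) snd_bar[of v] by (metis UnE bar_bar image_iff insertCI)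
  qed
  ultimately show ?thesis
    unfolding u pmul_add_left sc transversal_insert[OF assms(1,2)]
    using True P by (auto simp: pmul_basis_single g)
next
  case False
  have "\<not> transversal (insert v A) x"
    using False assms(3) finite_subset[of x "insert v A \<union> bar ` insert v A"]
    by (auto simp: transversal_def)
  then show ?thesis using False by (simp add: pmul_def)
qed

text \<open>A transversal picks one vertex from each factor, and every antipode picked from a factor
  of \<open>b\<close> costs a sign. The induction runs through \<open>b\<close> first and then
  through \<open>a\<close>, following the nesting in \<open>bracket\<close>.\<close>

lemma bracket_apply:
  assumes "finite a" "finite b" "a \<inter> b = {}" "\<forall>v\<in>a \<union> b. snd v"
  shows "bracket a b x =
    (if transversal (a \<union> b) x then \<Prod>v\<in>b. if v \<in> x then 1 else - 1 else (0::'a::field))"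
proof -
  define h :: "vertex set \<Rightarrow> 'a" where
    "h = pprod (\<lambda>v. basis {v} - basis {bar v}) b (basis {})"
  have b: "h x = (if transversal b x then \<Prod>v\<in>b. if v \<in> x then 1 else - 1 else 0)" for x
    unfolding h_def using assms(2,4)
  proof (induction b arbitrary: x rule: finite_induct)
    case empty
    then show ?case by (auto simp: basis_def transversal_def)
  next
    case (insert v b)
    have *: "w \<noteq> bar v" "w \<noteq> v" if "w \<in> b" for w
    proof -
      have "snd w" "snd v" using insert.prems that by blast+
      then show "w \<noteq> bar v" using snd_bar[of v] by metis
      show "w \<noteq> v" using that insert.hyps(2) by blast
    qed
    let ?P = "\<lambda>x. \<Prod>w\<in>b. if w \<in> x then 1 else (- 1::'a)"
    have "pmul (basis {v} - basis {bar v}) (pprod (\<lambda>v. basis {v} - basis {bar v}) b (basis {})) x =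
      (if transversal (insert v b) x then (if v \<in> x then 1 else - 1) * ?P x else 0)"
    proof (rule pmul_transversal[where A = b and P = ?P])
      show "\<forall>w\<in>insert v b. snd w" "v \<notin> b" "finite b" using insert by blast+
      show "pprod (\<lambda>v. basis {v} - basis {bar v}) b (basis {}) x =
        (if transversal b x then ?P x else 0)" for x
        using insert.prems by (intro insert.IH) blast
      show "?P (x - {v}) = ?P x" "?P (x - {bar v}) = ?P x"
        by (rule prod.cong[OF refl], simp add: *)+
      show "basis {v} - basis {bar v} = basis {v} + scale (- 1) (basis {bar v})"
        by (simp add: fun_eq_iff)
    qed
    then show ?case unfolding pprod_insert[OF insert.hyps] prod.insert[OF insert.hyps] .
  qed
  show ?thesis
    unfolding bracket_def h_def[symmetric] using assms(1,3,4)
  proof (induction a arbitrary: x rule: finite_induct)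
    case (insert v a)
    have *: "w \<noteq> bar v" "w \<noteq> v" if "w \<in> b" for w
    proof -
      have "snd w" "snd v" using insert.prems that by blast+
      then show "w \<noteq> bar v" using snd_bar[of v] by metis
      show "w \<noteq> v" using that insert.prems(1) by blast
    qed
    let ?P = "\<lambda>x. \<Prod>w\<in>b. if w \<in> x then 1 else (- 1::'a)"
    have "pmul (basis {v} + basis {bar v}) (pprod (\<lambda>v. basis {v} + basis {bar v}) a h) x =
      (if transversal (insert v (a \<union> b)) x then (if v \<in> x then 1 else 1) * ?P x else 0)"
    proof (rule pmul_transversal[where A = "a \<union> b" and P = ?P])
      show "\<forall>w\<in>insert v (a \<union> b). snd w" "v \<notin> a \<union> b" "finite (a \<union> b)"
        using insert.prems insert.hyps assms(2) by blast+
      show "pprod (\<lambda>v. basis {v} + basis {bar v}) a h x =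
        (if transversal (a \<union> b) x then ?P x else 0)" for x
        using insert.prems by (intro insert.IH) blast+
      show "?P (x - {v}) = ?P x" "?P (x - {bar v}) = ?P x"
        by (rule prod.cong[OF refl], simp add: *)+
      show "basis {v} + basis {bar v} = basis {v} + scale 1 (basis {bar v})"
        by (simp add: fun_eq_iff)
    qed
    then show ?case unfolding pprod_insert[OF insert.hyps] Un_insert_left if_cancel mult_1 .
  qed (simp add: b)
qed

lemma transversal_flip:
  assumes "transversal A x" "v \<in> x" "bar v \<notin> x"
  shows "transversal A (flip v x)"
proof -
  have "v \<in> A \<or> bar v \<in> A"
    using assms(1,2) by (force simp: transversal_def)
  then have "bar v \<in> A \<union> bar ` A" by (metis UnCI bar_bar imageI)
  moreover have mem: "u \<in> flip v x \<longleftrightarrow> u = bar v \<or> u \<in> x \<and> u \<noteq> v" for u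
    by (auto simp: flip_def)
  moreover have "bar w = v \<longleftrightarrow> w = bar v" for w
    by (metis bar_bar)
  then have "w \<in> flip v x \<longleftrightarrow> bar w \<notin> flip v x" if "w \<in> x \<longleftrightarrow> bar w \<notin> x" for w
    using that by (cases "w = v"; cases "w = bar v") (simp_all add: mem)
  moreover have "x \<subseteq> A \<union> bar ` A" "\<forall>w\<in>A. w \<in> x \<longleftrightarrow> bar w \<notin> x"
    using assms(1) by (simp_all add: transversal_def)
  ultimately show ?thesis
    unfolding transversal_def by (simp add: subset_iff)
qed

lemma transversal_flip_iff:
  assumes "v \<in> x" "bar v \<notin> x"
  shows "transversal A (flip v x) \<longleftrightarrow> transversal A x"
proof
  assume "transversal A (flip v x)"
  then have "transversal A (flip (bar v) (flip v x))"
    by (rule transversal_flip) (use assms in \<open>auto simp: flip_def\<close>)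
  moreover have "flip (bar v) (flip v x) = x"
    using assms by (auto simp: flip_def)
  ultimately show "transversal A x" by simp
qed (use assms transversal_flip in blast)

text \<open>Allows sums over a monomial \<open>x\<close> to be reindexed by \<open>A\<close>, and
  gives the degree of \<open>x\<close>.\<close>

lemma transversal_pos:
  assumes "transversal A x" "\<forall>v\<in>A. snd v"
  shows "bij_betw pos x A"
proof (intro bij_betw_imageI)
  have nb: "bar v \<notin> x" if "v \<in> x" for v
    using assms that unfolding transversal_def by (metis Un_iff bar_bar image_iff subsetD)
  show "inj_on pos x"
    using nb by (auto simp: inj_on_def pos_eq_iff)
  show "pos ` x = A"
  proof (intro equalityI subsetI)
    fix w assume "w \<in> pos ` x"
    then obtain v where v: "v \<in> x" "w = pos v" by blast
    then have "v \<in> A \<union> bar ` A" using assms by (auto simp: transversal_def)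
    then show "w \<in> A" using v assms(2) by (auto simp: pos_id)
  next
    fix w assume w: "w \<in> A"
    then have "w \<in> x \<or> bar w \<in> x" using assms by (auto simp: transversal_def)
    then show "w \<in> pos ` x"
      using w assms(2) pos_id[of w] pos_bar[of w] by (metis imageI)
  qed
qed

lemma transversal_face:
  assumes "transversal A x" "A \<subseteq> pos_verts n"
  shows "x \<in> faces n (card A)"
proof -
  have snd: "\<forall>v\<in>A. snd v" using assms(2) by (auto simp: pos_verts_def)
  have "A \<subseteq> verts n" using assms(2) by (auto simp: pos_verts_def verts_def)
  then have "A \<union> bar ` A \<subseteq> verts n" by auto
  moreover have "x \<subseteq> A \<union> bar ` A" using assms(1) by (simp add: transversal_def)
  ultimately have "x \<subseteq> verts n" by (rule order_trans[rotated])
  moreover have "bar v \<notin> x" if "v \<in> x" for v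
    using assms(1) that unfolding transversal_def by (metis Un_iff bar_bar image_iff subsetD)
  moreover have "card x = card A"
    using transversal_pos[OF assms(1) snd] by (rule bij_betw_same_card)
  ultimately show ?thesis
    by (simp add: faces_iff)
qed

lemma finite_pos_verts [simp]: "finite (pos_verts n)"
  by (simp add: pos_verts_def)

lemma bracket_in_chain_space:
  assumes "a \<subseteq> pos_verts n" "b \<subseteq> pos_verts n" "a \<inter> b = {}"
  shows "bracket a b \<in> chain_space n (card a + card b)"
proof -
  have fin: "finite a" "finite b" using assms finite_subset finite_pos_verts by blast+
  have "card (a \<union> b) = card a + card b" using fin assms(3) by (rule card_Un_disjoint)
  moreover have "\<forall>v\<in>a \<union> b. snd v" using assms by (auto simp: pos_verts_def)
  ultimately show ?thesis
    using transversal_face[of "a \<union> b" _ n] assms fin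
    by (auto simp: chain_space_def bracket_apply)
qed

text \<open>Flipping a vertex of a transversal negates its coefficient exactly if the vertex belongs
  to a pair of \<open>b\<close>. Over all vertices the factor 1 occurs \<open>card a\<close> times
  and the factor -1 occurs \<open>card b\<close> times.\<close>

lemma tau_bracket:
  assumes "a \<subseteq> pos_verts n" "b \<subseteq> pos_verts n" "a \<inter> b = {}"
  shows "tau n (card a + card b) (bracket a b) =
         scale (of_int (int (card a) - int (card b))) (bracket a b :: vertex set \<Rightarrow> 'a::field)"
proof
  fix x
  have fin: "finite a" "finite b" using assms finite_subset finite_pos_verts by blast+
  have snd: "\<forall>v\<in>a \<union> b. snd v" using assms by (auto simp: pos_verts_def)
  have card: "card (a \<union> b) = card a + card b" using fin assms(3) by (rule card_Un_disjoint)
  let ?g = "bracket a b :: vertex set \<Rightarrow> 'a"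
  note app = bracket_apply[OF fin assms(3) snd]
  show "tau n (card a + card b) ?g x = scale (of_int (int (card a) - int (card b))) ?g x"
  proof (cases "transversal (a \<union> b) x")
    case False
    have "?g (flip v x) = 0" if "x \<in> faces n (card a + card b)" "v \<in> x" for v
      using that False transversal_flip_iff[of v x] by (auto simp: app faces_iff)
    then show ?thesis using False by (simp add: tau_def app)
  next
    case True
    then have x: "x \<in> faces n (card a + card b)"
      using transversal_face[of "a \<union> b" x n] assms card by simp
    then have nb: "bar v \<notin> x" if "v \<in> x" for v using that by (auto simp: faces_iff)
    have "?g (flip v x) = (if pos v \<in> b then - 1 else 1) * ?g x" if v: "v \<in> x" for v
    proof -
      have tr: "transversal (a \<union> b) (flip v x)"
        using True v nb transversal_flip by blast
      have other: "w \<in> flip v x \<longleftrightarrow> w \<in> x" if "w \<in> b" "w \<noteq> pos v" for w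
      proof -
        have "pos w = w" using that snd by (simp add: pos_id)
        then have "w \<noteq> v" "w \<noteq> bar v" using that(2) by auto
        then show ?thesis by (simp add: flip_def)
      qed
      show ?thesis
      proof (cases "pos v \<in> b")
        case pb: True
        \<comment> \<open>Only the factor at \<open>pos v\<close> of the sign product is affected,
          and it changes sign.\<close>
        have "pos v \<in> flip v x \<longleftrightarrow> pos v \<notin> x"
          using pos_cases[of v] v nb[OF v] by (auto simp: flip_def)
        then show ?thesis
          using True tr fin pb other by (simp add: app prod.remove[of b "pos v"])
      next
        case False
        then have "w \<in> flip v x \<longleftrightarrow> w \<in> x" if "w \<in> b" for w
          using other that by blast
        then show ?thesis using True tr False by (simp add: app)
      qed
    qed
    then have "tau n (card a + card b) ?g x = (\<Sum>v\<in>x. (if pos v \<in> b then - 1 else 1) * ?g x)"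
      using x by (simp add: tau_def)
    also have "\<dots> = (\<Sum>v\<in>x. if pos v \<in> b then - 1 else 1) * ?g x"
      by (simp add: sum_distrib_right)
    also have "(\<Sum>v\<in>x. if pos v \<in> b then - 1 else 1) = (\<Sum>w\<in>a \<union> b. if w \<in> b then - 1 else (1::'a))"
      using transversal_pos[OF True snd] by (rule sum.reindex_bij_betw)
    also have "\<dots> = (\<Sum>w\<in>a. if w \<in> b then - 1 else 1) + (\<Sum>w\<in>b. if w \<in> b then - 1 else 1)"
      using fin assms(3) by (rule sum.union_disjoint)
    also have "(\<Sum>w\<in>a. if w \<in> b then - 1 else 1) = (\<Sum>w\<in>a. 1 :: 'a)"
      using assms(3) by (intro sum.cong) auto
    finally show ?thesis by simp
  qed
qed

text \<open>A vertex is half the sum, and its antipode half the difference, of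
  \<open>v + bar v\<close> and \<open>v - bar v\<close>. Rewriting the vertices of \<open>x\<close>
  in this way one at a time yields brackets; this is where 2 is inverted.\<close>

lemma basis_in_span_brackets:
  assumes "finite x" "\<forall>v\<in>x. bar v \<notin> x" and two: "(2::'a::field) \<noteq> 0"
  shows "(basis x :: vertex set \<Rightarrow> 'a) \<in>
    fvs.span {bracket a b | a b. a \<inter> b = {} \<and> a \<union> b = pos ` x}"
  using assms(1,2)
proof (induction x rule: finite_induct)
  case empty
  have "(basis {} :: vertex set \<Rightarrow> 'a) = bracket {} {}" by (simp add: bracket_def)
  then show ?case by (intro fvs.span_base) auto
next
  case (insert v x)
  let ?B = "\<lambda>x. {bracket a b :: vertex set \<Rightarrow> 'a | a b. a \<inter> b = {} \<and> a \<union> b = pos ` x}"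
  let ?S = "fvs.span (?B (insert v x))"
  have "bar v \<notin> x" using insert.prems by auto
  then have v: "pos v \<notin> pos ` x"
    using insert.hyps(2) by (auto simp: pos_eq_iff)
  have "pmul (basis {v}) g \<in> ?S" if "g \<in> fvs.span (?B x)" for g
    using that
  proof (induction rule: fvs.span_induct_alt)
    case base
    have "pmul (basis {v}) 0 = (0 :: vertex set \<Rightarrow> 'a)" by (simp add: pmul_def fun_eq_iff)
    then show ?case by (simp only: fvs.span_zero)
  next
    case (step c g h)
    then obtain a b where ab: "g = bracket a b" "a \<inter> b = {}" "a \<union> b = pos ` x" by blast
    have fin: "finite a" "finite b"
      using ab(3) insert.hyps(1) by (metis finite_Un finite_imageI)+
    let ?w = "pos v"
    have w: "?w \<notin> a" "?w \<notin> b" using v ab(3) by auto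
    have p: "pmul (basis {?w} + basis {bar ?w}) g = bracket (insert ?w a) b"
      using w fin by (simp add: ab bracket_def)
    \<comment> \<open>The factors for \<open>b\<close> are the inner ones in \<open>bracket\<close>,
      so \<open>pprod_pmul\<close> is needed to move the new factor past those of
      \<open>a\<close>.\<close>
    have m: "pmul (basis {?w} - basis {bar ?w}) g = bracket a (insert ?w b)"
      using w fin by (simp add: ab bracket_def pprod_pmul)
    have pS: "bracket (insert ?w a) b \<in> ?S" "bracket a (insert ?w b) \<in> ?S"
    proof -
      have "insert ?w a \<inter> b = {}" "insert ?w a \<union> b = pos ` insert v x"
        "a \<inter> insert ?w b = {}" "a \<union> insert ?w b = pos ` insert v x"
        using ab w by simp_all
      then show "bracket (insert ?w a) b \<in> ?S" "bracket a (insert ?w b) \<in> ?S"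
        by (rule_tac fvs.span_base, blast)+
    qed
    \<comment> \<open>The two alternatives correspond to \<open>v = pos v\<close> and
      \<open>v = bar (pos v)\<close>.\<close>
    have "pmul (basis {v}) g = scale (1/2) (bracket (insert ?w a) b + bracket a (insert ?w b)) \<or>
          pmul (basis {v}) g = scale (1/2) (bracket (insert ?w a) b - bracket a (insert ?w b))"
    proof -
      have half: "A = scale (1/2) ((A + B) + (A - B))" "B = scale (1/2) ((A + B) - (A - B))"
        for A B :: "vertex set \<Rightarrow> 'a"
        using two by (simp_all add: fun_eq_iff field_simps)
      have "pmul (basis {v}) g = pmul (basis {?w}) g \<or> pmul (basis {v}) g = pmul (basis {bar ?w}) g"
        using pos_cases[of v] by (metis bar_bar)
      then show ?thesis
        unfolding p[symmetric] m[symmetric] pmul_add_left pmul_diff_left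
        using half(1)[of "pmul (basis {?w}) g" "pmul (basis {bar ?w}) g"]
          half(2)[of "pmul (basis {bar ?w}) g" "pmul (basis {?w}) g"] by argo
    qed
    then have "pmul (basis {v}) g \<in> ?S"
      using fvs.span_scale[OF fvs.span_add[OF pS], of "1/2"]
        fvs.span_scale[OF fvs.span_diff[OF pS], of "1/2"]
      by (elim disjE) (simp_all only:)
    then show ?case
      using step(2) unfolding pmul_add_right pmul_scale_right
      by (intro fvs.span_add fvs.span_scale)
  qed
  moreover have "(basis x :: vertex set \<Rightarrow> 'a) \<in> fvs.span (?B x)"
    by (rule insert.IH) (use insert.prems in blast)
  ultimately have "pmul (basis {v}) (basis x) \<in> ?S" by blast
  also have "pmul (basis {v}) (basis x) = (basis (insert v x) :: vertex set \<Rightarrow> 'a)"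
    using insert.hyps by (subst pmul_basis) auto
  finally show ?case .
qed

section \<open>Eigenspaces\<close>

text \<open>As a simp rule, \<open>scale_apply\<close> would also unfold \<open>scale c f\<close> wherever it occurs eta-expanded.\<close>

declare scale_apply [simp del]

section \<open>Linear maps and their eigenvectors\<close>

lemma module_homI:
  assumes "\<And>f g. T (f + g) = T f + T g" "\<And>c f. T (scale c f) = scale c (T f)"
  shows "module_hom scale scale T"
  using assms by (auto simp: module_hom_iff fvs.module_axioms)

lemma eps_hom: "module_hom scale scale (eps n k)"
  by (rule module_homI) (auto simp: fun_eq_iff scale_apply eps_apply sum.distrib sum_distrib_left)

lemma bd_hom: "module_hom scale scale (bd n k)"
proof (cases k)
  case (Suc k')
  show ?thesis unfolding Suc
    by (rule module_homI) (auto simp: fun_eq_iff scale_apply bd_apply sum.distrib sum_distrib_left)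
qed (auto intro!: module_homI simp: fun_eq_iff scale_apply)

lemma tau_hom: "module_hom scale scale (tau n k)"
  by (rule module_homI) (auto simp: fun_eq_iff scale_apply tau_def sum.distrib sum_distrib_left)

lemmas bd_lin = module_hom.add[OF bd_hom] module_hom.diff[OF bd_hom] module_hom.scale[OF bd_hom]
  module_hom.sum[OF bd_hom] module_hom.zero[OF bd_hom]
lemmas eps_lin = module_hom.add[OF eps_hom] module_hom.diff[OF eps_hom] module_hom.scale[OF eps_hom]
  module_hom.sum[OF eps_hom] module_hom.zero[OF eps_hom]

lemma nu_plus_hom: "module_hom scale scale (nu_plus n k)"
  by (intro module_homI) (simp_all add: nu_plus_def eps_lin bd_lin)

lemma subspace_eigen:
  assumes "module_hom scale scale T"
  shows "fvs.subspace {f. T f = scale c f}"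
  by (intro fvs.subspaceI)
     (simp_all add: module_hom.add[OF assms] module_hom.scale[OF assms] module_hom.zero[OF assms]
        fvs.scale_right_distrib fvs.scale_left_commute)

lemma subspace_chain_space: "fvs.subspace (chain_space n k)"
  by (intro fvs.subspaceI) (simp_all add: chain_space_def scale_apply)

text \<open>Applying \<open>T\<close> to the relation and subtracting \<open>ev a\<close> times the
  relation removes \<open>v a\<close>. What is left is a relation between the eigenvectors
  \<open>scale (ev i - ev a) (v i)\<close>, to which the induction hypothesis applies.\<close>

lemma eigen_independent:
  assumes T: "module_hom scale scale T"
    and "finite I" "inj_on ev I" "\<And>i. i \<in> I \<Longrightarrow> T (v i) = scale (ev i) (v i)"
    and "(\<Sum>i\<in>I. v i) = 0" "i \<in> I"
  shows "v i = 0"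
  using assms(2-)
proof (induction I arbitrary: v i rule: finite_induct)
  case (insert a I)
  have sum: "v a + (\<Sum>i\<in>I. v i) = 0"
    using insert.prems(3) unfolding sum.insert[OF insert.hyps] .
  have "T (v a + (\<Sum>i\<in>I. v i)) = T (v a) + T (\<Sum>i\<in>I. v i)"
    by (rule module_hom.add[OF T])
  also have "T (v a) = scale (ev a) (v a)"
    by (rule insert.prems(2)) blast
  also have "T (\<Sum>i\<in>I. v i) = (\<Sum>i\<in>I. T (v i))"
    by (rule module_hom.sum[OF T])
  also have "\<dots> = (\<Sum>i\<in>I. scale (ev i) (v i))"
    by (rule sum.cong[OF refl insert.prems(2)]) blast
  finally have "T (v a + (\<Sum>i\<in>I. v i)) = scale (ev a) (v a) + (\<Sum>i\<in>I. scale (ev i) (v i))" .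
  then have "scale (ev a) (v a) + (\<Sum>i\<in>I. scale (ev i) (v i)) = 0"
    unfolding sum module_hom.zero[OF T] by (rule sym)
  moreover have "scale (ev a) (v a) + (\<Sum>i\<in>I. scale (ev a) (v i)) = 0"
    using arg_cong[OF sum, of "scale (ev a)"]
    by (simp only: fvs.scale_right_distrib fvs.scale_sum_right fvs.scale_zero_right)
  ultimately have "scale (ev a) (v a) + (\<Sum>i\<in>I. scale (ev i) (v i)) =
      scale (ev a) (v a) + (\<Sum>i\<in>I. scale (ev a) (v i))"
    by (rule trans[OF _ sym])
  then have "(\<Sum>i\<in>I. scale (ev i) (v i)) - (\<Sum>i\<in>I. scale (ev a) (v i)) = 0"
    by (simp only: add_left_cancel right_minus_eq)
  then have "(\<Sum>i\<in>I. scale (ev i - ev a) (v i)) = 0"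
    by (simp only: fvs.scale_left_diff_distrib sum_subtractf)
  moreover have "T (scale (ev i - ev a) (v i)) = scale (ev i) (scale (ev i - ev a) (v i))"
    if "i \<in> I" for i
    unfolding module_hom.scale[OF T] insert.prems(2)[OF insertI2[OF that]]
    by (rule fvs.scale_left_commute)
  moreover have "inj_on ev I" using insert.prems(1) by simp
  ultimately have sc: "scale (ev i - ev a) (v i) = 0" if "i \<in> I" for i
    using insert.IH[of "\<lambda>i. scale (ev i - ev a) (v i)"] that by blast
  have v: "v i = 0" if "i \<in> I" for i
  proof -
    have "ev i \<noteq> ev a"
      using inj_onD[OF insert.prems(1), of i a] that insert.hyps(2) by blast
    then show ?thesis using sc[OF that] unfolding fvs.scale_eq_0_iff by simp
  qed
  then have "(\<Sum>i\<in>I. v i) = 0" by (rule sum.neutral[OF ballI])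
  then have "v a = 0" using sum by (simp only: add_0_right)
  then show ?case using v insert.prems(4) by blast
qed simp

text \<open>\<open>T - \<mu>\<close> annihilates \<open>f\<close> and multiplies each
  \<open>v i\<close> by \<open>ev i - \<mu>\<close>, so \<open>eigen_independent\<close> applies to
  these multiples. The value \<open>\<mu>\<close> may differ from all \<open>ev i\<close>; then
  every component vanishes.\<close>

lemma eigen_component:
  assumes T: "module_hom scale scale T"
    and I: "finite I" "inj_on ev I" "\<And>i. i \<in> I \<Longrightarrow> T (v i) = scale (ev i) (v i)"
    and f: "f = (\<Sum>i\<in>I. v i)" "T f = scale \<mu> f" and "i \<in> I" "ev i \<noteq> \<mu>"
  shows "v i = 0"
proof -
  have "T f = (\<Sum>i\<in>I. scale (ev i) (v i))"
    unfolding f(1) module_hom.sum[OF T] by (rule sum.cong[OF refl I(3)])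
  then have "(\<Sum>i\<in>I. scale (ev i - \<mu>) (v i)) = 0"
    unfolding f(2) unfolding f(1) by (simp only: fvs.scale_left_diff_distrib sum_subtractf fvs.scale_sum_right) simp
  moreover have "T (scale (ev i - \<mu>) (v i)) = scale (ev i) (scale (ev i - \<mu>) (v i))"
    if "i \<in> I" for i
    unfolding module_hom.scale[OF T] I(3)[OF that] by (rule fvs.scale_left_commute)
  ultimately have "scale (ev i - \<mu>) (v i) = 0"
    using eigen_independent[OF T I(1,2), of "\<lambda>i. scale (ev i - \<mu>) (v i)"] \<open>i \<in> I\<close> by blast
  then show ?thesis using \<open>ev i \<noteq> \<mu>\<close> unfolding fvs.scale_eq_0_iff by simp
qed

section \<open>Joint eigenspaces of \<open>tau\<close> and \<open>nu_plus\<close>\<close>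

definition tau_space :: "nat \<Rightarrow> nat \<Rightarrow> nat \<Rightarrow> (vertex set \<Rightarrow> 'a::field) set" where
  "tau_space n k j = {f \<in> chain_space n k. tau n k f = scale (of_int (int k - 2 * int j)) f}"

lemma subspace_tau_space: "fvs.subspace (tau_space n k j)"
  using fvs.subspace_inter[OF subspace_chain_space subspace_eigen[OF tau_hom]]
  by (simp add: tau_space_def Int_def)

lemma Ekj_subset_tau_space: "Ekj n k j \<subseteq> (tau_space n k j :: (vertex set \<Rightarrow> 'a::field) set)"
  unfolding Ekj_def
proof (rule fvs.span_minimal[OF _ subspace_tau_space], safe)
  fix a b :: "vertex set"
  assume ab: "a \<subseteq> pos_verts n" "b \<subseteq> pos_verts n" "a \<inter> b = {}"
    and k: "k = card a + card b" and j: "j = card b"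
  have "int (card a) - int (card b) = int k - 2 * int j" using k j by simp
  then show "(bracket a b :: vertex set \<Rightarrow> 'a) \<in> tau_space n (card a + card b) (card b)"
    using bracket_in_chain_space[OF ab, where ?'a = 'a] tau_bracket[OF ab, where ?'a = 'a] k j
    by (simp add: tau_space_def)
qed

text \<open>By \<open>tau_eps\<close> the eigenvalue grows by 1 together with \<open>k\<close>, so
  \<open>j\<close> is unchanged; \<open>bd_tau_space\<close> is the dual.\<close>

lemma eps_tau_space:
  assumes "f \<in> tau_space n k j" shows "eps n k f \<in> tau_space n (Suc k) j"
proof -
  have "tau n (Suc k) (eps n k f) = eps n k (scale (of_int (int k - 2 * int j)) f + f)"
    using assms by (simp add: tau_eps tau_space_def)
  also have "\<dots> = scale (of_int (int k - 2 * int j) + 1) (eps n k f)"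
    by (simp only: eps_lin fvs.scale_left_distrib fvs.scale_one)
  finally show ?thesis using eps_in_chain_space[of n k f] by (simp add: tau_space_def algebra_simps)
qed

lemma bd_tau_space:
  assumes "f \<in> tau_space n (Suc k) j" shows "bd n (Suc k) f \<in> tau_space n k j"
proof -
  have "tau n k (bd n (Suc k) f) = bd n (Suc k) (scale (of_int (int (Suc k) - 2 * int j)) f - f)"
    unfolding tau_bd using assms by (simp only: tau_space_def mem_Collect_eq)
  also have "\<dots> = scale (of_int (int (Suc k) - 2 * int j) - 1) (bd n (Suc k) f)"
    by (simp only: bd_lin fvs.scale_left_diff_distrib fvs.scale_one)
  also have "of_int (int (Suc k) - 2 * int j) - 1 = (of_int (int k - 2 * int j) :: 'a)"
    by simp
  finally show ?thesis using bd_in_chain_space[of n "Suc k" f] by (simp add: tau_space_def)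
qed

text \<open>Here \<open>tau\<close> is the scalar \<open>k - 2 * j\<close>, so \<open>bd_eps\<close>
  leaves the scalar \<open>(2 * n - 3 * k) - (k - 2 * j)\<close>.\<close>

lemma nu_plus_tau_space:
  assumes "f \<in> tau_space n k j"
  shows "nu_plus n k f = eps n (k - 1) (bd n k f) + scale (of_int (2 * (int n - 2 * int k + int j))) f"
proof -
  have "nu_plus n k f = eps n (k - 1) (bd n k f) + scale (of_int (2 * int n - 3 * int k)) f
      - scale (of_int (int k - 2 * int j)) f"
    using assms bd_eps[of f n k] by (simp add: nu_plus_def tau_space_def)
  also have "\<dots> = eps n (k - 1) (bd n k f) +
      scale (of_int ((2 * int n - 3 * int k) - (int k - 2 * int j))) f"
    by (simp only: of_int_diff fvs.scale_left_diff_distrib add_diff_eq)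
  finally show ?thesis by (simp add: algebra_simps)
qed

definition nu_ev :: "nat \<Rightarrow> nat \<Rightarrow> nat \<Rightarrow> nat \<Rightarrow> int" where
  "nu_ev n k j i = 2 * (int k - int j + 1 - int i) * (int n - int k - int i)"

text \<open>With \<open>tau_space\<close> in place of \<open>Ekj\<close>, stability under
  \<open>eps\<close> and \<open>bd\<close> can be shown without brackets; \<open>Ekji_eq_eig\<close>
  identifies the result with \<open>Ekji\<close>.\<close>

definition eig :: "nat \<Rightarrow> nat \<Rightarrow> nat \<Rightarrow> nat \<Rightarrow> (vertex set \<Rightarrow> 'a::field) set" where
  "eig n k j i = {g \<in> tau_space n k j. nu_plus n k g = scale (of_int (nu_ev n k j i)) g}"

lemma subspace_eig: "fvs.subspace (eig n k j i)"
  using fvs.subspace_inter[OF subspace_tau_space subspace_eigen[OF nu_plus_hom]]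
  by (simp add: eig_def Int_def)

text \<open>The increment is the scalar of \<open>nu_plus_tau_space\<close> at level
  \<open>Suc k\<close>; this is why \<open>eps\<close> and \<open>bd\<close> preserve the index
  \<open>i\<close>.\<close>

lemma nu_ev_Suc: "nu_ev n k j i + 2 * (int n - 2 * int (Suc k) + int j) = nu_ev n (Suc k) j i"
  by (simp add: nu_ev_def algebra_simps)

lemma eps_eig:
  assumes "h \<in> eig n k j i" shows "eps n k h \<in> eig n (Suc k) j i"
proof -
  have h: "h \<in> tau_space n k j" "bd n (Suc k) (eps n k h) = scale (of_int (nu_ev n k j i)) h"
    using assms by (simp_all add: eig_def nu_plus_def)
  have "nu_plus n (Suc k) (eps n k h) =
      scale (of_int (nu_ev n k j i)) (eps n k h) +
      scale (of_int (2 * (int n - 2 * int (Suc k) + int j))) (eps n k h)"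
    unfolding nu_plus_tau_space[OF eps_tau_space[OF h(1)]] diff_Suc_1 h(2) eps_lin ..
  also have "\<dots> = scale (of_int (nu_ev n (Suc k) j i)) (eps n k h)"
    unfolding nu_ev_Suc[symmetric] of_int_add fvs.scale_left_distrib ..
  finally show ?thesis using eps_tau_space[OF h(1)] by (simp only: eig_def mem_Collect_eq simp_thms)
qed

text \<open>Subtracting the scalar of \<open>nu_plus_tau_space\<close> from the eigenvalue at level
  \<open>Suc k\<close> leaves the eigenvalue at level \<open>k\<close>. Where that is nonzero in the
  field, \<open>bd\<close> is injective on the eigenspace.\<close>

lemma eps_bd_eig:
  assumes "h \<in> eig n (Suc k) j i"
  shows "eps n k (bd n (Suc k) h) = scale (of_int (nu_ev n k j i)) h"
proof -
  have h: "h \<in> tau_space n (Suc k) j" "nu_plus n (Suc k) h = scale (of_int (nu_ev n (Suc k) j i)) h"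
    using assms by (simp_all add: eig_def)
  have "scale (of_int (nu_ev n k j i)) h + scale (of_int (2 * (int n - 2 * int (Suc k) + int j))) h
      = scale (of_int (nu_ev n (Suc k) j i)) h"
    unfolding nu_ev_Suc[symmetric] of_int_add fvs.scale_left_distrib ..
  also have "\<dots> = eps n k (bd n (Suc k) h) +
      scale (of_int (2 * (int n - 2 * int (Suc k) + int j))) h"
    using nu_plus_tau_space[OF h(1)] unfolding h(2) diff_Suc_1 .
  finally show ?thesis by (simp only: add_right_cancel)
qed

lemma bd_eig:
  assumes "h \<in> eig n (Suc k) j i" shows "bd n (Suc k) h \<in> eig n k j i"
proof -
  have "nu_plus n k (bd n (Suc k) h) = scale (of_int (nu_ev n k j i)) (bd n (Suc k) h)"
    using eps_bd_eig[OF assms] by (simp add: nu_plus_def bd_lin)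
  moreover have "h \<in> tau_space n (Suc k) j" using assms by (simp add: eig_def)
  ultimately show ?thesis using bd_tau_space by (simp add: eig_def)
qed

lemma chain_space_sum_basis:
  assumes "f \<in> chain_space n k" shows "f = (\<Sum>x\<in>faces n k. scale (f x) (basis x))"
proof
  fix y
  have "(\<Sum>x\<in>faces n k. scale (f x) (basis x)) y = (\<Sum>x\<in>faces n k. if y = x then f x else 0)"
    by (simp add: fun_sum_apply basis_def scale_apply if_distrib cong: if_cong)
  then show "f y = (\<Sum>x\<in>faces n k. scale (f x) (basis x)) y"
    using assms by (simp add: chain_space_def)
qed

section \<open>Consequences of the assumption on the characteristic\<close>

locale good_char =
  fixes n :: nat and field_type :: "'a::field itself"
  \<comment> \<open>For \<open>n \<le> 1\<close> the bound \<open>CHAR('a) > n\<close> still admits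
    characteristic 2, where \<open>v + bar v\<close> and \<open>v - bar v\<close> coincide.\<close>
  assumes char: "CHAR('a) = 0 \<or> CHAR('a) > n" and char_neq_2: "CHAR('a) \<noteq> 2"
begin

lemma of_int_neq_0:
  assumes "z \<noteq> 0" "\<bar>z\<bar> \<le> int n" shows "of_int z \<noteq> (0::'a)"
proof
  assume "of_int z = (0::'a)"
  then have "int CHAR('a) dvd z" by (simp add: of_int_eq_0_iff_char_dvd)
  then have "int CHAR('a) \<le> \<bar>z\<bar>" "CHAR('a) \<noteq> 0"
    using assms(1) dvd_imp_le_int[of z "int CHAR('a)"] by auto
  then show False using assms(2) char by linarith
qed

lemma two_neq_0: "(2::'a) \<noteq> 0"
proof
  assume "(2::'a) = 0"
  then have "of_nat 2 = (0::'a)" by simp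
  then have "CHAR('a) dvd 2" by (simp only: of_nat_eq_0_iff_char_dvd)
  then have "CHAR('a) \<le> 2" "CHAR('a) \<noteq> 0" by (auto dest: dvd_imp_le intro: gr0I)
  then show False using char_neq_2 CHAR_not_1[where ?'a = 'a] by linarith
qed

lemma of_int_mult_neq_0:
  assumes "0 < a" "a \<le> int n" "0 < b" "b \<le> int n" shows "of_int (2 * a * b) \<noteq> (0::'a)"
  using of_int_neq_0[of a] of_int_neq_0[of b] two_neq_0 assms by simp

lemma tau_ev_inj: "K \<le> n \<Longrightarrow> inj_on (\<lambda>j. of_int (int k - 2 * int j) :: 'a) {..K}"
proof (rule inj_onI)
  fix j j' assume "K \<le> n" "j \<in> {..K}" "j' \<in> {..K}"
    and "of_int (int k - 2 * int j) = (of_int (int k - 2 * int j') :: 'a)"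
  then have "of_int (2 * (int j' - int j)) = (0::'a)" by (simp add: algebra_simps)
  then have "of_int (int j' - int j) = (0::'a)" using two_neq_0 by auto
  then show "j = j'"
    using of_int_neq_0[of "int j' - int j"] \<open>K \<le> n\<close> \<open>j \<in> {..K}\<close> \<open>j' \<in> {..K}\<close> by force
qed

lemma ev_inj:
  assumes "j \<le> k" "k \<le> n" shows "inj_on (\<lambda>i. of_int (nu_ev n k j i) :: 'a) {..min (k - j) (n - k)}"
proof -
  have *: "of_int (nu_ev n k j i) \<noteq> (of_int (nu_ev n k j i') :: 'a)"
    if "i < i'" "i' \<le> min (k - j) (n - k)" for i i'
  proof -
    \<comment> \<open>The last factor lies between 1 and \<open>n\<close>, because
      \<open>i + i' \<le> (k - j) + (n - k) = n - j\<close> and \<open>i' \<ge> 1\<close>.\<close>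
    have "nu_ev n k j i - nu_ev n k j i' = 2 * (int i' - int i) * (int n - int j + 1 - int i - int i')"
      by (simp add: nu_ev_def algebra_simps)
    moreover have "of_int (2 * (int i' - int i) * (int n - int j + 1 - int i - int i')) \<noteq> (0::'a)"
      using that assms by (intro of_int_mult_neq_0) auto
    ultimately show ?thesis by (metis of_int_diff right_minus_eq)
  qed
  then show ?thesis
    by (intro linorder_inj_onI) auto
qed

text \<open>The functions of the required form are a subspace \<open>S\<close> that contains all
  brackets of degree \<open>k\<close>, hence every \<open>k\<close>-face by
  \<open>basis_in_span_brackets\<close>.\<close>

lemma chain_space_decomposition:
  fixes f :: "vertex set \<Rightarrow> 'a"
  assumes "f \<in> chain_space n k"
  shows "\<exists>g. (\<forall>j\<le>k. g j \<in> Ekj n k j) \<and> f = (\<Sum>j\<le>k. g j)"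
proof -
  define S :: "(vertex set \<Rightarrow> 'a) set" where
    "S = {f. \<exists>g. (\<forall>j\<le>k. g j \<in> Ekj n k j) \<and> f = (\<Sum>j\<le>k. g j)}"
  have E: "fvs.subspace (Ekj n k j :: (vertex set \<Rightarrow> 'a) set)" for j
    unfolding Ekj_def by (rule fvs.subspace_span)
  have S: "fvs.subspace S"
  proof (rule fvs.subspaceI)
    show "0 \<in> S" unfolding S_def mem_Collect_eq
      by (rule exI[of _ "\<lambda>_. 0"]) (simp add: fvs.subspace_0[OF E])
  next
    fix x y assume "x \<in> S" "y \<in> S"
    then obtain g h where "\<forall>j\<le>k. g j \<in> Ekj n k j" "x = (\<Sum>j\<le>k. g j)"
      "\<forall>j\<le>k. h j \<in> Ekj n k j" "y = (\<Sum>j\<le>k. h j)" unfolding S_def by blast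
    then show "x + y \<in> S" unfolding S_def mem_Collect_eq
      by (intro exI[of _ "\<lambda>j. g j + h j"]) (simp add: sum.distrib fvs.subspace_add[OF E])
  next
    fix c x assume "x \<in> S"
    then obtain g where "\<forall>j\<le>k. g j \<in> Ekj n k j" "x = (\<Sum>j\<le>k. g j)" unfolding S_def by blast
    then show "scale c x \<in> S" unfolding S_def mem_Collect_eq
      by (intro exI[of _ "\<lambda>j. scale c (g j)"]) (simp add: fvs.scale_sum_right fvs.subspace_scale[OF E])
  qed
  have br: "(bracket a b :: vertex set \<Rightarrow> 'a) \<in> S"
    if ab: "a \<subseteq> pos_verts n" "b \<subseteq> pos_verts n" "a \<inter> b = {}" "card a + card b = k" for a b
  proof -
    define g :: "nat \<Rightarrow> vertex set \<Rightarrow> 'a" where "g = (\<lambda>j. if j = card b then bracket a b else 0)"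
    have "bracket a b \<in> Ekj n k (card b)"
      unfolding Ekj_def using ab by (intro fvs.span_base) blast
    then have "g j \<in> Ekj n k j" for j
      using fvs.subspace_0[OF E, of j] by (cases "j = card b") (simp_all only: g_def if_True if_False simp_thms)
    moreover have "(\<Sum>j\<le>k. g j) = bracket a b"
      using ab(4) by (simp add: g_def)
    ultimately show ?thesis unfolding S_def by (intro CollectI exI[of _ g]) simp
  qed
  have "basis x \<in> S" if "x \<in> faces n k" for x
  proof -
    have x: "finite x" "\<forall>v\<in>x. bar v \<notin> x" "x \<subseteq> verts n" "card x = k"
      using that finite_face by (auto simp: faces_iff)
    have inj: "inj_on pos x"
      using x(2) by (auto simp: inj_on_def pos_eq_iff)
    have sub: "pos ` x \<subseteq> pos_verts n"
      using x(3) by (auto simp: verts_def pos_verts_def pos_def)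
    have "{bracket a b | a b. a \<inter> b = {} \<and> a \<union> b = pos ` x} \<subseteq> S"
    proof safe
      fix a b assume ab: "a \<inter> b = {}" "a \<union> b = pos ` x"
      have fin: "finite a" "finite b" using ab(2) x(1) by (metis finite_Un finite_imageI)+
      have "card a + card b = card (pos ` x)"
        using card_Un_disjoint[OF fin ab(1)] ab(2) by simp
      also have "\<dots> = k" using inj x(4) by (simp add: card_image)
      finally show "bracket a b \<in> S"
        using ab sub by (intro br) auto
    qed
    then show ?thesis
      using basis_in_span_brackets[OF x(1,2) two_neq_0] fvs.span_minimal[OF _ S] by blast
  qed
  then have "(\<Sum>x\<in>faces n k. scale (f x) (basis x)) \<in> S"
    by (intro fvs.subspace_sum[OF S] fvs.subspace_scale[OF S])
  then show ?thesis
    unfolding S_def chain_space_sum_basis[OF assms, symmetric] by blast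
qed

lemma tau_eq:
  assumes "g \<in> tau_space n k j" shows "tau n k g = scale (of_int (int k - 2 * int j)) g"
  using assms by (simp add: tau_space_def)

text \<open>For the inclusion of \<open>tau_space\<close>, \<open>f\<close> is split into parts in
  the spaces \<open>Ekj n k j'\<close>. Their \<open>tau\<close> eigenvalues are distinct, so the
  parts with \<open>j' \<noteq> j\<close> vanish.\<close>

lemma Ekj_eq_tau_space:
  assumes "j \<le> k" "k \<le> n"
  shows "Ekj n k j = (tau_space n k j :: (vertex set \<Rightarrow> 'a) set)"
proof (intro equalityI subsetI)
  fix f :: "vertex set \<Rightarrow> 'a" assume f: "f \<in> tau_space n k j"
  then have "f \<in> chain_space n k" by (simp add: tau_space_def)
  then obtain g where g: "\<forall>j\<le>k. g j \<in> Ekj n k j" and fg: "f = (\<Sum>j\<le>k. g j)"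
    using chain_space_decomposition by blast
  have "g j' = 0" if "j' \<le> k" "j' \<noteq> j" for j'
  proof (rule eigen_component[OF tau_hom _ tau_ev_inj[OF assms(2)] _ fg tau_eq[OF f]])
    show "tau n k (g i) = scale (of_int (int k - 2 * int i)) (g i)" if "i \<in> {..k}" for i
      using g that Ekj_subset_tau_space by (intro tau_eq) blast
    show "of_int (int k - 2 * int j') \<noteq> (of_int (int k - 2 * int j) :: 'a)"
      using inj_onD[OF tau_ev_inj[OF assms(2)], of k j' j] that assms by blast
  qed (use that in auto)
  then have "(\<Sum>j'\<in>{..k} - {j}. g j') = 0" by (intro sum.neutral) auto
  then have "f = g j" using fg assms by (simp add: sum.remove[of "{..k}" j])
  then show "f \<in> Ekj n k j" using g assms by blast
qed (use Ekj_subset_tau_space in blast)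

text \<open>In the field, \<open>k - 2 * j\<close> differs from every \<open>k - 2 * j'\<close> with
  \<open>j' \<le> k\<close>, so all components of \<open>f\<close> vanish. Used for boundaries of
  elements of \<open>tau_space n j j\<close>.\<close>

lemma tau_space_trivial:
  fixes f :: "vertex set \<Rightarrow> 'a"
  assumes "k < j" "j \<le> n" "f \<in> tau_space n k j" shows "f = 0"
proof -
  have "f \<in> chain_space n k" using assms by (simp add: tau_space_def)
  then obtain g where g: "\<forall>j\<le>k. g j \<in> Ekj n k j" and fg: "f = (\<Sum>j\<le>k. g j)"
    using chain_space_decomposition by blast
  have "k \<le> n" using assms by simp
  have "g j' = 0" if "j' \<le> k" for j'
  proof (rule eigen_component[OF tau_hom _ tau_ev_inj[OF \<open>k \<le> n\<close>] _ fg tau_eq[OF assms(3)]])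
    show "tau n k (g i) = scale (of_int (int k - 2 * int i)) (g i)" if "i \<in> {..k}" for i
      using g that Ekj_subset_tau_space by (intro tau_eq) blast
    show "of_int (int k - 2 * int j') \<noteq> (of_int (int k - 2 * int j) :: 'a)"
      using inj_onD[OF tau_ev_inj[OF assms(2)], of k j' j] that assms by force
  qed (use that in auto)
  then show ?thesis using fg by (simp add: sum.neutral)
qed

lemma Ekji_eq_eig:
  assumes "j \<le> k" "k \<le> n"
  shows "Ekji n k j i = (eig n k j i :: (vertex set \<Rightarrow> 'a) set)"
  using Ekj_eq_tau_space[OF assms] by (simp add: Ekji_def eig_def nu_ev_def)

end

section \<open>The spectral decomposition\<close>

context good_char
begin

text \<open>Induction upwards from \<open>k = j\<close>. The parts \<open>h i\<close> of the
  boundary of \<open>g\<close> are lifted by \<open>eps\<close>, rescaled so that their boundaries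
  are again the \<open>h i\<close>. The remainder \<open>d\<close> is killed by \<open>bd\<close>
  and is the eigenvector for the new index \<open>Suc k - j\<close>.\<close>

lemma exists_nu_decomposition_low:
  assumes "j \<le> k" "2 * k \<le> n + j" "(g :: vertex set \<Rightarrow> 'a) \<in> tau_space n k j"
  shows "\<exists>c. (\<forall>i\<le>k - j. c i \<in> eig n k j i) \<and> g = (\<Sum>i\<le>k - j. c i)"
  using assms
proof (induction k arbitrary: g rule: dec_induct)
  case base
  have "bd n j g = 0"
  proof (cases j)
    case (Suc j')
    then have "bd n j g \<in> tau_space n j' j" using base bd_tau_space by blast
    then show ?thesis using tau_space_trivial[of j' j "bd n j g"] Suc base(1) by linarith
  qed simp
  then have "nu_plus n j g = scale (of_int (2 * (int n - 2 * int j + int j))) g"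
    using nu_plus_tau_space[OF base(2)] by (simp only: eps_lin add_0)
  then have "g \<in> eig n j j 0"
    using base(2) by (simp add: eig_def nu_ev_def)
  then show ?case by (intro exI[of _ "\<lambda>_. g"]) simp
next
  case (step k)
  then obtain h where h: "\<And>i. i \<le> k - j \<Longrightarrow> h i \<in> eig n k j i"
    and bdg: "bd n (Suc k) g = (\<Sum>i\<le>k - j. h i)"
    using step.IH[OF _ bd_tau_space[OF step.prems(2)]] by auto
  \<comment> \<open>Both factors are positive: \<open>i \<le> k - j\<close> and
    \<open>2 * Suc k \<le> n + j\<close> give \<open>n - k - i \<ge> 2\<close>.\<close>
  have nz: "of_int (nu_ev n k j i) \<noteq> (0::'a)" if "i \<le> k - j" for i
    unfolding nu_ev_def using that step by (intro of_int_mult_neq_0) auto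
  define e where "e i = scale (1 / of_int (nu_ev n k j i)) (eps n k (h i))" for i
  define d where "d = g - (\<Sum>i\<le>k - j. e i)"
  have e: "e i \<in> eig n (Suc k) j i" if "i \<le> k - j" for i
    unfolding e_def using that h by (intro fvs.subspace_scale[OF subspace_eig] eps_eig)
  have "bd n (Suc k) (e i) = h i" if "i \<le> k - j" for i
  proof -
    have "bd n (Suc k) (eps n k (h i)) = scale (of_int (nu_ev n k j i)) (h i)"
      using h[OF that] by (simp add: eig_def nu_plus_def)
    then show ?thesis
      unfolding e_def bd_lin using nz[OF that] by simp
  qed
  then have "bd n (Suc k) d = 0"
    unfolding d_def bd_lin bdg by simp
  moreover have d: "d \<in> tau_space n (Suc k) j"
    unfolding d_def using e step.prems(2)
    by (intro fvs.subspace_diff[OF subspace_tau_space] fvs.subspace_sum[OF subspace_tau_space])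
       (auto simp: eig_def)
  ultimately have "nu_plus n (Suc k) d = scale (of_int (2 * (int n - 2 * int (Suc k) + int j))) d"
    using nu_plus_tau_space[OF d] by (simp only: eps_lin add_0)
  \<comment> \<open>For this index the first factor of the eigenvalue is 1.\<close>
  also have "2 * (int n - 2 * int (Suc k) + int j) = nu_ev n (Suc k) j (Suc k - j)"
    using step.hyps by (simp add: nu_ev_def of_nat_diff)
  finally have d: "d \<in> eig n (Suc k) j (Suc k - j)"
    using d by (simp only: eig_def mem_Collect_eq simp_thms)
  define c where "c i = (if i \<le> k - j then e i else d)" for i
  have S: "Suc k - j = Suc (k - j)" using step.hyps by simp
  have "c i \<in> eig n (Suc k) j i" if "i \<le> Suc k - j" for i
  proof (cases "i \<le> k - j")
    case False
    then have "i = Suc k - j" using that by simp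
    then show ?thesis using d False by (simp only: c_def if_False)
  qed (use e in \<open>simp only: c_def if_True\<close>)
  moreover have "(\<Sum>i\<le>Suc k - j. c i) = (\<Sum>i\<le>k - j. c i) + c (Suc (k - j))"
    unfolding S by (rule sum.atMost_Suc)
  moreover have "(\<Sum>i\<le>k - j. c i) = (\<Sum>i\<le>k - j. e i)"
    by (intro sum.cong refl) (simp only: c_def atMost_iff if_True)
  moreover have "c (Suc (k - j)) = d" by (simp add: c_def)
  ultimately show ?case unfolding d_def by (intro exI[of _ c]) (simp only: add_diff_cancel_left' add.commute diff_add_cancel, simp)
qed

text \<open>The mirror image: induction downwards from \<open>k = n\<close> with \<open>eps\<close>
  and \<open>bd\<close> exchanged. The remainder is killed by \<open>eps\<close>, so it has
  eigenvalue 0, which belongs to \<open>i = n - k\<close>.\<close>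

lemma exists_nu_decomposition_high:
  assumes "k \<le> n" "j \<le> k" "n + j \<le> 2 * k" "(g :: vertex set \<Rightarrow> 'a) \<in> tau_space n k j"
  shows "\<exists>c. (\<forall>i\<le>n - k. c i \<in> eig n k j i) \<and> g = (\<Sum>i\<le>n - k. c i)"
  using assms
proof (induction k arbitrary: g rule: inc_induct)
  case base
  \<comment> \<open>There are no faces with \<open>Suc n\<close> vertices.\<close>
  have "eps n n g = 0"
    using card_free(2)[of _ n "Suc n"] by (auto simp: fun_eq_iff eps_apply)
  then have "nu_plus n n g = 0" by (simp add: nu_plus_def bd_lin)
  then have "g \<in> eig n n j 0"
    using base by (simp add: eig_def nu_ev_def)
  then show ?case by (intro exI[of _ "\<lambda>_. g"]) simp
next
  case (step k)
  then obtain h where h: "\<And>i. i \<le> n - Suc k \<Longrightarrow> h i \<in> eig n (Suc k) j i"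
    and epsg: "eps n k g = (\<Sum>i\<le>n - Suc k. h i)"
    using step.IH[OF _ _ eps_tau_space[OF step.prems(3)]] by auto
  have nz: "of_int (nu_ev n k j i) \<noteq> (0::'a)" if "i \<le> n - Suc k" for i
    unfolding nu_ev_def using that step by (intro of_int_mult_neq_0) auto
  define e where "e i = scale (1 / of_int (nu_ev n k j i)) (bd n (Suc k) (h i))" for i
  define d where "d = g - (\<Sum>i\<le>n - Suc k. e i)"
  have e: "e i \<in> eig n k j i" if "i \<le> n - Suc k" for i
    unfolding e_def using that h by (intro fvs.subspace_scale[OF subspace_eig] bd_eig)
  have "eps n k (e i) = h i" if "i \<le> n - Suc k" for i
    unfolding e_def eps_lin using nz[OF that] eps_bd_eig[OF h[OF that]] by simp
  then have "eps n k d = 0"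
    unfolding d_def eps_lin epsg by simp
  then have "nu_plus n k d = scale (of_int (nu_ev n k j (n - k))) d"
    using step.hyps by (simp add: nu_plus_def bd_lin nu_ev_def of_nat_diff)
  moreover have "d \<in> tau_space n k j"
    unfolding d_def using e step.prems(3)
    by (intro fvs.subspace_diff[OF subspace_tau_space] fvs.subspace_sum[OF subspace_tau_space])
       (auto simp: eig_def)
  ultimately have d: "d \<in> eig n k j (n - k)"
    by (simp only: eig_def mem_Collect_eq simp_thms)
  define c where "c i = (if i \<le> n - Suc k then e i else d)" for i
  have S: "n - k = Suc (n - Suc k)" using step.hyps by simp
  have "c i \<in> eig n k j i" if "i \<le> n - k" for i
  proof (cases "i \<le> n - Suc k")
    case False
    then have "i = n - k" using that by simp
    then show ?thesis using d False by (simp only: c_def if_False)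
  qed (use e in \<open>simp only: c_def if_True\<close>)
  moreover have "(\<Sum>i\<le>n - k. c i) = (\<Sum>i\<le>n - Suc k. c i) + c (Suc (n - Suc k))"
    unfolding S by (rule sum.atMost_Suc)
  moreover have "(\<Sum>i\<le>n - Suc k. c i) = (\<Sum>i\<le>n - Suc k. e i)"
    by (intro sum.cong refl) (simp only: c_def atMost_iff if_True)
  moreover have "c (Suc (n - Suc k)) = d" by (simp add: c_def)
  ultimately show ?case unfolding d_def by (intro exI[of _ c]) (simp only: add_diff_cancel_left' add.commute diff_add_cancel, simp)
qed

text \<open>\<open>2 * k \<le> n + j\<close> says that \<open>k - j \<le> n - k\<close>, so the two
  inductions cover both values of the minimum.\<close>

lemma exists_nu_decomposition:
  assumes "k \<le> n" "j \<le> k" "(g :: vertex set \<Rightarrow> 'a) \<in> tau_space n k j"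
  shows "\<exists>c. (\<forall>i\<le>min (k - j) (n - k). c i \<in> eig n k j i) \<and> g = (\<Sum>i\<le>min (k - j) (n - k). c i)"
proof (cases "2 * k \<le> n + j")
  case True
  then have "min (k - j) (n - k) = k - j" using assms by simp
  then show ?thesis using exists_nu_decomposition_low[OF assms(2) True assms(3)] by simp
next
  case False
  then have "min (k - j) (n - k) = n - k" "n + j \<le> 2 * k" using assms by simp_all
  then show ?thesis using exists_nu_decomposition_high[OF assms(1,2) _ assms(3)] by simp
qed

section \<open>Existence and independence of the full decomposition\<close>

lemma nu_eq: "h \<in> eig n k j i \<Longrightarrow> nu_plus n k h = scale (of_int (nu_ev n k j i)) h"
  by (simp add: eig_def)

lemma exists_decomposition:
  assumes "k \<le> n" "(f :: vertex set \<Rightarrow> 'a) \<in> chain_space n k"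
  shows "\<exists>c. (\<forall>j\<le>k. \<forall>i\<le>min (k - j) (n - k). c j i \<in> eig n k j i) \<and>
    f = (\<Sum>j\<le>k. \<Sum>i\<le>min (k - j) (n - k). c j i)"
proof -
  obtain g where g: "\<forall>j\<le>k. g j \<in> Ekj n k j" and fg: "f = (\<Sum>j\<le>k. g j)"
    using chain_space_decomposition[OF assms(2)] by blast
  have "\<exists>c. (\<forall>i\<le>min (k - j) (n - k). c i \<in> eig n k j i) \<and> g j = (\<Sum>i\<le>min (k - j) (n - k). c i)"
    if "j \<le> k" for j
    using exists_nu_decomposition[OF assms(1) that, of "g j"] g that Ekj_subset_tau_space by blast
  then obtain c where c: "\<And>j i. j \<le> k \<Longrightarrow> i \<le> min (k - j) (n - k) \<Longrightarrow> c j i \<in> eig n k j i"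
    "\<And>j. j \<le> k \<Longrightarrow> g j = (\<Sum>i\<le>min (k - j) (n - k). c j i)"
    by metis
  have "f = (\<Sum>j\<le>k. \<Sum>i\<le>min (k - j) (n - k). c j i)"
    unfolding fg by (rule sum.cong[OF refl c(2)]) simp
  with c(1) show ?thesis by blast
qed

text \<open>The eigenvalues of \<open>tau\<close> separate the indices \<open>j\<close>; then, for
  fixed \<open>j\<close>, those of \<open>nu_plus\<close> separate the indices
  \<open>i\<close>.\<close>

lemma decomposition_independent:
  fixes c :: "nat \<Rightarrow> nat \<Rightarrow> vertex set \<Rightarrow> 'a"
  assumes "k \<le> n"
    and c: "\<And>j i. j \<le> k \<Longrightarrow> i \<le> min (k - j) (n - k) \<Longrightarrow> c j i \<in> eig n k j i"
    and sum: "(\<Sum>j\<le>k. \<Sum>i\<le>min (k - j) (n - k). c j i) = 0"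
    and ji: "j \<le> k" "i \<le> min (k - j) (n - k)"
  shows "c j i = 0"
proof -
  have "(\<Sum>i\<le>min (k - j) (n - k). c j i) \<in> tau_space n k j" if "j \<le> k" for j
    using c[OF that] by (intro fvs.subspace_sum[OF subspace_tau_space]) (auto simp: eig_def)
  then have "(\<Sum>i\<le>min (k - j) (n - k). c j i) = 0"
    using eigen_independent[OF tau_hom _ tau_ev_inj[OF assms(1)],
        where v = "\<lambda>j. \<Sum>i\<le>min (k - j) (n - k). c j i" and i = j] ji(1) sum tau_eq
    by blast
  then show ?thesis
    using eigen_independent[OF nu_plus_hom _ ev_inj[OF ji(1) assms(1)], where v = "c j" and i = i]
      c[OF ji(1)] ji(2) nu_eq by blast
qed

text \<open>Because \<open>i = k + 1 - j\<close>, the boundary of \<open>h\<close> has eigenvalue 0.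
  The eigenvalues that occur in \<open>tau_space n k j\<close> are those with
  \<open>i' \<le> min (k - j) (n - k)\<close>, and they are nonzero. If \<open>j = k + 1\<close>,
  already \<open>tau_space n k j\<close> is trivial.\<close>

lemma bd_top_component:
  assumes "(h :: vertex set \<Rightarrow> 'a) \<in> eig n (Suc k) j i" "j + i = Suc k" "Suc k + i \<le> n"
  shows "bd n (Suc k) h = 0"
proof (cases "j \<le> k")
  case False
  then have "k < j" "j \<le> n" using assms by simp_all
  moreover have "bd n (Suc k) h \<in> tau_space n k j"
    using assms(1) by (simp add: eig_def bd_tau_space)
  ultimately show ?thesis by (rule tau_space_trivial)
next
  case True
  have b: "bd n (Suc k) h \<in> eig n k j i" using assms(1) by (rule bd_eig)
  have kn: "k \<le> n" using assms by simp
  let ?m = "min (k - j) (n - k)"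
  obtain c where c: "\<And>i. i \<le> ?m \<Longrightarrow> c i \<in> eig n k j i"
    and sum: "bd n (Suc k) h = (\<Sum>i\<le>?m. c i)"
    using exists_nu_decomposition[OF kn True, of "bd n (Suc k) h"] b by (auto simp: eig_def)
  have ev: "of_int (nu_ev n k j i) = (0::'a)"
  proof -
    have "int k - int j + 1 - int i = 0" using assms(2) by linarith
    then have "nu_ev n k j i = 0" by (simp only: nu_ev_def mult_zero_right mult_zero_left)
    then show ?thesis by simp
  qed
  have "c i' = 0" if "i' \<le> ?m" for i'
  proof (rule eigen_component[OF nu_plus_hom _ ev_inj[OF True kn] _ sum nu_eq[OF b]])
    show "nu_plus n k (c i) = scale (of_int (nu_ev n k j i)) (c i)" if "i \<in> {..?m}" for i
      using c that by (intro nu_eq) simp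
    have "of_int (nu_ev n k j i') \<noteq> (0::'a)"
      unfolding nu_ev_def using that assms(2,3) True by (intro of_int_mult_neq_0) auto
    then show "of_int (nu_ev n k j i') \<noteq> (of_int (nu_ev n k j i) :: 'a)" using ev by simp
  qed (use that in auto)
  then show ?thesis unfolding sum by (intro sum.neutral) simp
qed

end

section \<open>Summation over the faces above a face\<close>

text \<open>For \<open>t \<le> k\<close> and \<open>f\<close> in \<open>chain_space n k\<close>,
  iterating \<open>bd_restrict_sum\<close> shows that \<open>fact (k - t)\<close> times this is the
  \<open>(k - t)\<close>-fold boundary of \<open>f\<close>. Defining it as a sum keeps the counting
  visible.\<close>

definition restrict_sum :: "nat \<Rightarrow> nat \<Rightarrow> nat \<Rightarrow> (vertex set \<Rightarrow> 'a::field) \<Rightarrow> vertex set \<Rightarrow> 'a" where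
  "restrict_sum n k t f z = (if z \<in> faces n t then \<Sum>y | y \<in> faces n k \<and> z \<subseteq> y. f y else 0)"

lemma restrict_sum_hom: "module_hom scale scale (restrict_sum n k t)"
  by (rule module_homI)
     (auto simp: fun_eq_iff scale_apply restrict_sum_def sum.distrib sum_distrib_left)

lemmas restrict_sum_lin = module_hom.add[OF restrict_sum_hom] module_hom.diff[OF restrict_sum_hom]
  module_hom.scale[OF restrict_sum_hom] module_hom.sum[OF restrict_sum_hom]
  module_hom.zero[OF restrict_sum_hom]

lemma faces_above_self:
  assumes "z \<in> faces n k" shows "{y. y \<in> faces n k \<and> z \<subseteq> y} = {z}"
proof (intro equalityI subsetI)
  fix y assume "y \<in> {y. y \<in> faces n k \<and> z \<subseteq> y}"
  then have y: "y \<in> faces n k" "z \<subseteq> y" by simp_all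
  then have "card z = card y" using assms by (simp add: faces_iff)
  with y finite_face[OF y(1)] show "y \<in> {z}" using card_subset_eq by blast
qed (use assms in simp)

lemma restrict_sum_self:
  assumes "f \<in> chain_space n k" shows "restrict_sum n k k f = f"
proof
  fix z
  show "restrict_sum n k k f z = f z"
    using assms faces_above_self[of z n k] by (auto simp: restrict_sum_def chain_space_def)
qed

text \<open>Double counting of the pairs \<open>(w, y)\<close> with \<open>w \<in> y - z\<close>:
  each \<open>y\<close> has \<open>k - t\<close> such vertices. The general semiring serves both
  counting in \<open>nat\<close> and sums in the field.\<close>

lemma sum_faces_insert:
  fixes f :: "vertex set \<Rightarrow> 'b::comm_semiring_1"
  assumes "z \<in> faces n t"
  shows "(\<Sum>w\<in>free n z. \<Sum>y | y \<in> faces n k \<and> insert w z \<subseteq> y. f y) =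
    of_nat (k - t) * (\<Sum>y | y \<in> faces n k \<and> z \<subseteq> y. f y)"
proof -
  let ?Y = "{y. y \<in> faces n k \<and> z \<subseteq> y}"
  have fin: "finite ?Y" by simp
  have "(\<Sum>w\<in>free n z. \<Sum>y | y \<in> faces n k \<and> insert w z \<subseteq> y. f y) =
      (\<Sum>w\<in>free n z. \<Sum>y\<in>?Y. if w \<in> y then f y else 0)"
  proof (rule sum.cong[OF refl])
    fix w
    have "{y. y \<in> faces n k \<and> insert w z \<subseteq> y} = {y \<in> ?Y. w \<in> y}" by blast
    then show "(\<Sum>y | y \<in> faces n k \<and> insert w z \<subseteq> y. f y) = (\<Sum>y\<in>?Y. if w \<in> y then f y else 0)"
      by (simp only: sum.inter_filter[OF fin])
  qed
  also have "\<dots> = (\<Sum>y\<in>?Y. \<Sum>w\<in>free n z. if w \<in> y then f y else 0)"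
    by (rule sum.swap)
  also have "\<dots> = (\<Sum>y\<in>?Y. of_nat (k - t) * f y)"
  proof (rule sum.cong[OF refl])
    fix y assume "y \<in> ?Y"
    then have y: "y \<subseteq> verts n" "card y = k" "z \<subseteq> y" "finite y" "\<forall>v\<in>y. bar v \<notin> y"
      using finite_face by (auto simp: faces_iff)
    have "{w \<in> free n z. w \<in> y} = y - z"
      using y(1,3,5) by (auto simp: free_def)
    moreover have "card (y - z) = k - t"
      using y assms finite_face[OF assms] by (simp add: card_Diff_subset faces_iff)
    ultimately show "(\<Sum>w\<in>free n z. if w \<in> y then f y else 0) = of_nat (k - t) * f y"
      by (simp flip: sum.inter_filter)
  qed
  finally show ?thesis by (simp only: sum_distrib_left)
qed

text \<open>Induction downwards from \<open>t = k\<close>. With \<open>f = 1\<close>,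
  \<open>sum_faces_insert\<close> relates the counts at \<open>t\<close> and \<open>Suc t\<close>
  through the \<open>2 * (n - t)\<close> free vertices, and the absorption identity for binomial
  coefficients closes the recursion.\<close>

lemma card_faces_above:
  assumes "t \<le> k" "k \<le> n" "z \<in> faces n t"
  shows "card {y. y \<in> faces n k \<and> z \<subseteq> y} = 2 ^ (k - t) * ((n - t) choose (k - t))"
  using assms(1,3)
proof (induction t arbitrary: z rule: inc_induct)
  case base
  then show ?case by (simp add: faces_above_self)
next
  case (step t)
  obtain d where d: "k - t = Suc d" "k - Suc t = d" using step.hyps by (metis Suc_diff_Suc)
  obtain m where m: "n - t = Suc m" "n - Suc t = m"
    using step.hyps assms(2) by (metis Suc_diff_Suc order_less_le_trans)
  have free: "card (free n z) = 2 * Suc m"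
    using card_free[OF step.prems] m by arith
  have "of_nat (Suc d) * (\<Sum>y | y \<in> faces n k \<and> z \<subseteq> y. 1::nat) =
      (\<Sum>w\<in>free n z. \<Sum>y | y \<in> faces n k \<and> insert w z \<subseteq> y. 1)"
    unfolding sum_faces_insert[OF step.prems] d ..
  also have "\<dots> = (\<Sum>w\<in>free n z. 2 ^ d * (m choose d))"
    using step.IH[OF face_insert[OF step.prems]] d m by (intro sum.cong) simp_all
  also have "\<dots> = 2 ^ Suc d * (Suc m * (m choose d))"
    using free by (simp add: algebra_simps)
  also have "\<dots> = Suc d * (2 ^ Suc d * (Suc m choose Suc d))"
    unfolding Suc_times_binomial[symmetric] by (simp only: mult.left_commute)
  finally show ?case unfolding d m by (simp del: mult_Suc mult_Suc_right power_Suc)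
qed

lemma bd_restrict_sum:
  "bd n (Suc t) (restrict_sum n k (Suc t) f) = scale (of_nat (k - t)) (restrict_sum n k t f)"
proof
  fix z
  show "bd n (Suc t) (restrict_sum n k (Suc t) f) z = scale (of_nat (k - t)) (restrict_sum n k t f) z"
  proof (cases "z \<in> faces n t")
    case True
    then have "bd n (Suc t) (restrict_sum n k (Suc t) f) z =
        (\<Sum>w\<in>free n z. \<Sum>y | y \<in> faces n k \<and> insert w z \<subseteq> y. f y)"
      by (simp add: bd_apply restrict_sum_def face_insert)
    then show ?thesis
      unfolding sum_faces_insert[OF True] using True by (simp add: restrict_sum_def scale_apply)
  qed (simp add: bd_apply restrict_sum_def scale_apply)
qed

section \<open>The sum of all faces\<close>

definition all_faces :: "nat \<Rightarrow> nat \<Rightarrow> vertex set \<Rightarrow> 'a::field" where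
  "all_faces n k = (\<Sum>x\<in>faces n k. basis x)"

lemma all_faces_apply: "all_faces n k x = (if x \<in> faces n k then 1 else 0)"
  by (simp add: all_faces_def fun_sum_apply sum_basis_apply)

text \<open>All \<open>k\<close> flips of a \<open>k\<close>-face are faces; and it has
  \<open>2 * (n - k)\<close> extensions, each containing \<open>k + 1\<close> faces of size
  \<open>k\<close>.\<close>

lemma all_faces_eig: "(all_faces n k :: vertex set \<Rightarrow> 'a::field) \<in> eig n k 0 0"
proof -
  let ?l = "all_faces n k :: vertex set \<Rightarrow> 'a"
  have tau: "tau n k ?l x = of_nat k * ?l x" for x
  proof (cases "x \<in> faces n k")
    case True
    then have "card x = k" by (simp add: faces_iff)
    then show ?thesis using True by (simp add: tau_def all_faces_apply face_flip)
  qed (simp add: tau_def all_faces_apply)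
  have nu: "nu_plus n k ?l x = of_int (nu_ev n k 0 0) * ?l x" for x
  proof (cases "x \<in> faces n k")
    case True
    have "eps n k ?l (insert w x) = of_nat (Suc k)" if "w \<in> free n x" for w
    proof -
      have w: "insert w x \<in> faces n (Suc k)" using True that by (rule face_insert)
      then show ?thesis
        using face_remove[OF w] by (simp add: eps_apply all_faces_apply faces_iff)
    qed
    then have "(\<Sum>w\<in>free n x. eps n k ?l (insert w x)) =
        (\<Sum>w\<in>free n x. of_nat (Suc k))"
      by (rule sum.cong[OF refl])
    then have "nu_plus n k ?l x = of_nat (card (free n x)) * of_nat (Suc k)"
      using True by (simp add: nu_plus_def bd_apply)
    also have "\<dots> = of_int (int (card (free n x)) * int (Suc k))"
      by simp
    also have "int (card (free n x)) * int (Suc k) = nu_ev n k 0 0"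
    proof -
      have c: "int (card (free n x)) = 2 * int n - 2 * int k"
        using card_free(1)[OF True] by linarith
      show ?thesis unfolding nu_ev_def c by (simp add: algebra_simps)
    qed
    finally have "nu_plus n k ?l x = of_int (nu_ev n k 0 0)" .
    moreover have "?l x = 1" using True by (simp add: all_faces_apply)
    ultimately show ?thesis by simp
  qed (simp add: nu_plus_def bd_apply all_faces_apply)
  show ?thesis
    using tau nu by (auto simp: eig_def tau_space_def chain_space_def all_faces_apply scale_apply fun_eq_iff)
qed

text \<open>The factor counts the \<open>k\<close>-faces above a \<open>t\<close>-face; it becomes
  the denominator in condition (a).\<close>

lemma restrict_sum_all_faces:
  assumes "t \<le> k" "k \<le> n"
  shows "restrict_sum n k t (all_faces n k) =
    scale (2 ^ (k - t) * of_nat ((n - t) choose (k - t))) (all_faces n t :: vertex set \<Rightarrow> 'a::field)"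
proof
  fix z
  show "restrict_sum n k t (all_faces n k) z =
    scale (2 ^ (k - t) * of_nat ((n - t) choose (k - t))) (all_faces n t :: vertex set \<Rightarrow> 'a) z"
    using card_faces_above[OF assms, of z]
    by (auto simp: restrict_sum_def scale_apply all_faces_apply)
qed

context good_char
begin

section \<open>Kernel and injectivity of the restriction sums\<close>

lemma of_nat_neq_0: "0 < m \<Longrightarrow> m \<le> n \<Longrightarrow> of_nat m \<noteq> (0::'a)"
  using of_int_neq_0[of "int m"] by simp

lemma of_nat_fact_neq_0: "m \<le> n \<Longrightarrow> of_nat (fact m) \<noteq> (0::'a)"
proof (induction m)
  case (Suc m)
  then show ?case using of_nat_neq_0[of "Suc m"] by (simp only: fact_Suc of_nat_mult of_nat_id) simp
qed simp

lemma of_nat_choose_neq_0: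
  assumes "d \<le> m" "m \<le> n" shows "of_nat (m choose d) \<noteq> (0::'a)"
proof
  assume "of_nat (m choose d) = (0::'a)"
  then have "of_nat (fact d * fact (m - d) * (m choose d)) = (0::'a)" by simp
  then show False
    using of_nat_fact_neq_0[OF assms(2)] unfolding binomial_fact_lemma[OF assms(1)] by simp
qed

text \<open>Induction downwards from \<open>t = k\<close>, one boundary per step. While
  \<open>j + i \<le> t\<close>, the scalar \<open>nu_ev n t j i\<close> by which \<open>eps\<close>
  after \<open>bd\<close> acts is nonzero, so nothing is lost. The step to
  \<open>t = j + i - 1\<close> is \<open>bd_top_component\<close>, and from there on only 0
  remains.\<close>

lemma restrict_sum_eig:
  assumes h: "(h :: vertex set \<Rightarrow> 'a) \<in> eig n k j i" and "k \<le> n" "j \<le> k" "i \<le> k - j" "i \<le> n - k" "t \<le> k"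
  shows "(j + i \<le> t \<longrightarrow> restrict_sum n k t h \<in> eig n t j i \<and> (restrict_sum n k t h = 0 \<longrightarrow> h = 0)) \<and>
    (t < j + i \<longrightarrow> restrict_sum n k t h = 0)"
  using assms(6)
proof (induction t rule: inc_induct)
  case base
  have "h \<in> chain_space n k" using h by (simp add: eig_def tau_space_def)
  then show ?case using restrict_sum_self[of h n k] h assms by auto
next
  case (step t)
  let ?u = "restrict_sum n k (Suc t) h"
  have kt: "of_nat (k - t) \<noteq> (0::'a)"
    using step.hyps assms by (intro of_nat_neq_0) auto
  have u: "restrict_sum n k t h = scale (1 / of_nat (k - t)) (bd n (Suc t) ?u)"
    unfolding bd_restrict_sum using kt by simp
  consider "j + i \<le> t" | "j + i = Suc t" | "Suc t < j + i" by linarith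
  then show ?case
  proof cases
    case 1
    then have ue: "?u \<in> eig n (Suc t) j i" and u0: "?u = 0 \<Longrightarrow> h = 0"
      using step.IH by auto
    have "restrict_sum n k t h \<in> eig n t j i"
      unfolding u by (intro fvs.subspace_scale[OF subspace_eig] bd_eig ue)
    moreover have "h = 0" if "restrict_sum n k t h = 0"
    proof -
      have "bd n (Suc t) ?u = 0" unfolding bd_restrict_sum that by simp
      then have "scale (of_int (nu_ev n t j i)) ?u = 0"
        unfolding eps_bd_eig[OF ue, symmetric] by (simp only: eps_lin)
      moreover have "of_int (nu_ev n t j i) \<noteq> (0::'a)"
        unfolding nu_ev_def using 1 assms step.hyps by (intro of_int_mult_neq_0) auto
      ultimately show ?thesis using u0 unfolding fvs.scale_eq_0_iff by blast
    qed
    moreover have "\<not> t < j + i" using 1 by simp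
    ultimately show ?thesis by blast
  next
    case 2
    then have "?u \<in> eig n (Suc t) j i" using step.IH by simp
    then have "bd n (Suc t) ?u = 0"
      using 2 assms step.hyps by (intro bd_top_component) auto
    then show ?thesis unfolding u using 2 by simp
  next
    case 3
    then have "?u = 0" using step.IH by blast
    then have "restrict_sum n k t h = 0" unfolding u by (simp add: bd_lin)
    then show ?thesis using 3 by simp
  qed
qed

text \<open>The definite description is justified: \<open>exists_decomposition\<close> provides a
  candidate, and \<open>decomposition_independent\<close>, applied to a difference, shows that there
  is no other.\<close>

lemma spectral_components_eq:
  fixes c :: "nat \<Rightarrow> nat \<Rightarrow> vertex set \<Rightarrow> 'a"
  assumes "k \<le> n" "f \<in> chain_space n k" "c = spectral_components n k f"
  shows "\<forall>j\<le>k. \<forall>i\<le>min (k - j) (n - k). c j i \<in> eig n k j i"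
    and "f = (\<Sum>j\<le>k. \<Sum>i\<le>min (k - j) (n - k). c j i)"
proof -
  let ?P = "\<lambda>c :: nat \<Rightarrow> nat \<Rightarrow> vertex set \<Rightarrow> 'a.
    (\<forall>j i. if j \<le> k \<and> i \<le> min (k - j) (n - k) then c j i \<in> Ekji n k j i else c j i = 0) \<and>
     f = (\<Sum>j\<le>k. \<Sum>i\<le>min (k - j) (n - k). c j i)"
  obtain c0 where c0: "\<forall>j\<le>k. \<forall>i\<le>min (k - j) (n - k). c0 j i \<in> eig n k j i"
    "f = (\<Sum>j\<le>k. \<Sum>i\<le>min (k - j) (n - k). c0 j i)"
    using exists_decomposition[OF assms(1,2)] by blast
  \<comment> \<open>The cut-off outside the index range follows the convention in
    \<open>spectral_components\<close>.\<close>
  define c1 where "c1 j i = (if j \<le> k \<and> i \<le> min (k - j) (n - k) then c0 j i else 0)" for j i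
  have "(\<Sum>j\<le>k. \<Sum>i\<le>min (k - j) (n - k). c1 j i) = (\<Sum>j\<le>k. \<Sum>i\<le>min (k - j) (n - k). c0 j i)"
    by (intro sum.cong refl) (simp only: c1_def atMost_iff simp_thms if_True)
  moreover have "c1 j i \<in> Ekji n k j i" if "j \<le> k \<and> i \<le> min (k - j) (n - k)" for j i
  proof -
    have "c1 j i = c0 j i" using that unfolding c1_def by (rule if_P)
    then show ?thesis using that c0(1) Ekji_eq_eig[OF _ assms(1), of j i] by simp
  qed
  moreover have "c1 j i = 0" if "\<not> (j \<le> k \<and> i \<le> min (k - j) (n - k))" for j i
    using that by (simp only: c1_def if_False)
  ultimately have P1: "?P c1" unfolding c0(2) by presburger
  have "c' = c1" if P: "?P c'" for c'
  proof (rule ext, rule ext)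
    fix j i
    show "c' j i = c1 j i"
    proof (cases "j \<le> k \<and> i \<le> min (k - j) (n - k)")
      case True
      have "c' j i - c1 j i = 0"
      proof (rule decomposition_independent[OF assms(1)])
        show "c' j i - c1 j i \<in> eig n k j i" if "j \<le> k" "i \<le> min (k - j) (n - k)" for j i
        proof -
          have "c' j i \<in> Ekji n k j i" "c1 j i \<in> Ekji n k j i" using P P1 that by meson+
          then show ?thesis
            unfolding Ekji_eq_eig[OF that(1) assms(1)] by (rule fvs.subspace_diff[OF subspace_eig])
        qed
        have "(\<Sum>j\<le>k. \<Sum>i\<le>min (k - j) (n - k). c' j i) = (\<Sum>j\<le>k. \<Sum>i\<le>min (k - j) (n - k). c1 j i)"
          using P P1 by (metis (no_types))
        then show "(\<Sum>j\<le>k. \<Sum>i\<le>min (k - j) (n - k). c' j i - c1 j i) = 0"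
          by (simp only: sum_subtractf right_minus_eq)
      qed (use True in auto)
      then show ?thesis by (simp only: right_minus_eq)
    next
      case False
      then show ?thesis using P P1 by (metis (no_types))
    qed
  qed
  then have "c = c1"
    unfolding assms(3) spectral_components_def using P1 by (intro the_equality) blast+
  then show "f = (\<Sum>j\<le>k. \<Sum>i\<le>min (k - j) (n - k). c j i)"
    using P1 by blast
  show "\<forall>j\<le>k. \<forall>i\<le>min (k - j) (n - k). c j i \<in> eig n k j i"
    unfolding \<open>c = c1\<close> c1_def using c0(1) by simp
qed

end

section \<open>Designs\<close>

text \<open>Components with \<open>j + i > t\<close> are killed. The others are mapped injectively
  into the different spaces \<open>eig n t j i\<close>, whose independence rules out
  cancellation.\<close>

lemma (in good_char) restrict_sum_eq_0_iff:
  fixes c :: "nat \<Rightarrow> nat \<Rightarrow> vertex set \<Rightarrow> 'a"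
  assumes kn: "k \<le> n" and tk: "t \<le> k"
    and c: "\<And>j i. j \<le> k \<Longrightarrow> i \<le> min (k - j) (n - k) \<Longrightarrow> c j i \<in> eig n k j i"
    and g: "g = (\<Sum>j\<le>k. \<Sum>i\<le>min (k - j) (n - k). c j i)"
  shows "restrict_sum n k t g = 0 \<longleftrightarrow> (\<forall>j\<le>t. \<forall>i\<le>min (t - j) (n - k). c j i = 0)"
proof -
  let ?r = "\<lambda>j i. restrict_sum n k t (c j i)"
  have r0: "?r j i = 0" if "j \<le> k" "i \<le> min (k - j) (n - k)" "t < j + i" for j i
    using restrict_sum_eig[OF c[OF that(1,2)] kn that(1) _ _ tk] that by simp
  have r: "?r j i \<in> eig n t j i" "?r j i = 0 \<longleftrightarrow> c j i = 0"
    if "j \<le> t" "i \<le> min (t - j) (n - k)" for j i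
  proof -
    have ji: "j \<le> k" "i \<le> k - j" "i \<le> n - k" "j + i \<le> t" using that tk by auto
    then have *: "?r j i \<in> eig n t j i \<and> (?r j i = 0 \<longrightarrow> c j i = 0)"
      using restrict_sum_eig[OF c kn _ _ _ tk, of j i] by simp
    then show "?r j i \<in> eig n t j i" by blast
    show "?r j i = 0 \<longleftrightarrow> c j i = 0" using * restrict_sum_lin(5) by metis
  qed
  have inner: "(\<Sum>i\<le>min (k - j) (n - k). ?r j i) = (\<Sum>i\<le>min (t - j) (n - k). ?r j i)"
    if "j \<le> t" for j
    using r0 that tk by (intro sum.mono_neutral_right) auto
  have outer: "restrict_sum n k t g = (\<Sum>j\<le>t. \<Sum>i\<le>min (t - j) (n - k). ?r j i)"
  proof -
    have "restrict_sum n k t g = (\<Sum>j\<le>k. \<Sum>i\<le>min (k - j) (n - k). ?r j i)"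
      unfolding g by (simp only: restrict_sum_lin)
    also have "\<dots> = (\<Sum>j\<le>t. \<Sum>i\<le>min (k - j) (n - k). ?r j i)"
      using r0 tk by (intro sum.mono_neutral_right) (auto intro!: sum.neutral)
    also have "\<dots> = (\<Sum>j\<le>t. \<Sum>i\<le>min (t - j) (n - k). ?r j i)"
      by (rule sum.cong[OF refl inner]) simp
    finally show ?thesis .
  qed
  show ?thesis
  proof
    assume "\<forall>j\<le>t. \<forall>i\<le>min (t - j) (n - k). c j i = 0"
    then have "?r j i = 0" if "j \<le> t" "i \<le> min (t - j) (n - k)" for j i
      using r(2) that by blast
    then show "restrict_sum n k t g = 0"
      unfolding outer by (intro sum.neutral ballI) simp
  next
    assume R0: "restrict_sum n k t g = 0"
    \<comment> \<open>At level \<open>t\<close> the index \<open>i\<close> may run up to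
      \<open>n - t\<close>, beyond \<open>n - k\<close>; the family is padded with 0 there.\<close>
    define e where "e j i = (if i \<le> n - k then ?r j i else 0)" for j i
    have e_r: "e j i = ?r j i" if "i \<le> n - k" for j i
      using that by (simp only: e_def if_True)
    have e_0: "e j i = 0" if "\<not> i \<le> n - k" for j i
      using that by (simp only: e_def if_False)
    have "e j i = 0" if "j \<le> t" "i \<le> min (t - j) (n - t)" for j i
    proof (rule decomposition_independent[OF _ _ _ that])
      show "t \<le> n" using tk kn by simp
      show "e j i \<in> eig n t j i" if "j \<le> t" "i \<le> min (t - j) (n - t)" for j i
      proof (cases "i \<le> n - k")
        case True
        then show ?thesis using r(1)[OF that(1)] that e_r by simp
      next
        case False
        then show ?thesis unfolding e_0[OF False] by (intro fvs.subspace_0 subspace_eig)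
      qed
      have "(\<Sum>i\<le>min (t - j) (n - t). e j i) = (\<Sum>i\<le>min (t - j) (n - k). ?r j i)" for j
      proof -
        have "(\<Sum>i\<le>min (t - j) (n - t). e j i) = (\<Sum>i\<le>min (t - j) (n - k). e j i)"
          using e_0 tk by (intro sum.mono_neutral_right) auto
        also have "\<dots> = (\<Sum>i\<le>min (t - j) (n - k). ?r j i)"
          using e_r by (intro sum.cong) simp_all
        finally show ?thesis .
      qed
      then show "(\<Sum>j\<le>t. \<Sum>i\<le>min (t - j) (n - t). e j i) = 0"
        using R0 unfolding outer by (simp only:)
    qed
    then have "?r j i = 0" if "j \<le> t" "i \<le> min (t - j) (n - k)" for j i
      using that tk e_r[of i j] by (metis diff_le_mono2 min.bounded_iff order_trans)
    then show "\<forall>j\<le>t. \<forall>i\<le>min (t - j) (n - k). c j i = 0"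
      using r(2) by blast
  qed
qed

text \<open>At a \<open>t\<close>-face the sum is the number of members of \<open>B\<close> above
  it, read in the field, and equality there is congruence modulo the characteristic.\<close>

lemma is_design_mod_iff:
  fixes f :: "vertex set \<Rightarrow> 'a::field"
  assumes "B \<subseteq> faces n k" "f = (\<Sum>x\<in>B. basis x)"
  shows "is_design_mod CHAR('a) n t k l B \<longleftrightarrow>
    restrict_sum n k t f = scale (of_nat l) (all_faces n t)"
proof -
  have fin: "finite B" using assms(1) finite_faces by (rule finite_subset)
  have "restrict_sum n k t f z = of_nat (card {y \<in> B. z \<subseteq> y})" if "z \<in> faces n t" for z
  proof -
    have "restrict_sum n k t f z = (\<Sum>y | y \<in> faces n k \<and> z \<subseteq> y. if y \<in> B then 1 else 0)"
      using that fin by (simp add: restrict_sum_def assms(2) fun_sum_apply sum_basis_apply)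
    also have "\<dots> = (\<Sum>y | y \<in> {y. y \<in> faces n k \<and> z \<subseteq> y} \<and> y \<in> B. 1)"
      by (rule sum.inter_filter[symmetric]) simp
    also have "{y. y \<in> {y. y \<in> faces n k \<and> z \<subseteq> y} \<and> y \<in> B} = {y \<in> B. z \<subseteq> y}"
      using assms(1) by blast
    finally show ?thesis by simp
  qed
  then have "restrict_sum n k t f = scale (of_nat l) (all_faces n t) \<longleftrightarrow>
      (\<forall>z\<in>faces n t. of_nat (card {y \<in> B. z \<subseteq> y}) = (of_nat l :: 'a))"
    by (auto simp: fun_eq_iff scale_apply all_faces_apply restrict_sum_def)
  then show ?thesis
    using assms(1) by (simp add: is_design_mod_def of_nat_eq_iff_cong_CHAR)
qed

lemma is_design_imp_is_design_mod: "is_design n t k l B \<Longrightarrow> is_design_mod p n t k l B"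
  by (simp add: is_design_def is_design_mod_def)

text \<open>Both sides of the congruence are below \<open>p\<close>, since the count is at most the
  number of all \<open>k\<close>-faces above a \<open>t\<close>-face.\<close>

lemma is_design_iff_is_design_mod:
  assumes "t \<le> k" "k \<le> n" "p > l" "p > 2 ^ (k - t) * ((n - t) choose (k - t))"
  shows "is_design n t k l B \<longleftrightarrow> is_design_mod p n t k l B"
proof
  assume d: "is_design_mod p n t k l B"
  have "card {y \<in> B. x \<subseteq> y} = l" if x: "x \<in> faces n t" for x
  proof (rule cong_less_modulus_unique_nat)
    show "[card {y \<in> B. x \<subseteq> y} = l] (mod p)" using d x by (simp add: is_design_mod_def)
    have "card {y \<in> B. x \<subseteq> y} \<le> card {y. y \<in> faces n k \<and> x \<subseteq> y}"
      using d by (intro card_mono) (auto simp: is_design_mod_def)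
    then show "card {y \<in> B. x \<subseteq> y} < p"
      using assms(4) card_faces_above[OF assms(1,2) x] by simp
  qed (use assms in simp)
  then show "is_design n t k l B" using d by (simp add: is_design_def is_design_mod_def)
qed (rule is_design_imp_is_design_mod)

text \<open>\<open>?L\<close> is the multiple of \<open>all_faces n k\<close> that
  \<open>restrict_sum\<close> sends to \<open>l\<close> times \<open>all_faces n t\<close>. So the
  design condition says that \<open>f - ?L\<close> lies in the kernel, and its components agree with
  those of \<open>f\<close> except at \<open>(0, 0)\<close>.\<close>

lemma (in good_char) is_design_mod_iff_spectral:
  fixes f :: "vertex set \<Rightarrow> 'a"
  assumes tk: "t \<le> k" and kn: "k \<le> n" and B: "B \<subseteq> faces n k" and f: "f = (\<Sum>x\<in>B. basis x)"
    and c: "c = spectral_components n k f"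
  shows "is_design_mod CHAR('a) n t k l B \<longleftrightarrow>
    c 0 0 = scale (of_nat l / (2 ^ (k - t) * of_nat ((n - t) choose (k - t)))) (all_faces n k) \<and>
    (\<forall>j i. (j, i) \<noteq> (0, 0) \<and> j \<le> t \<and> i \<le> min (t - j) (n - k) \<longrightarrow> c j i = 0)"
proof -
  have fin: "finite B" using B finite_faces by (rule finite_subset)
  have "f \<in> chain_space n k"
    using B fin by (auto simp: chain_space_def f fun_sum_apply sum_basis_apply)
  note comps = spectral_components_eq[OF kn this c]
  let ?N = "2 ^ (k - t) * of_nat ((n - t) choose (k - t)) :: 'a"
  let ?L = "scale (of_nat l / ?N) (all_faces n k) :: vertex set \<Rightarrow> 'a"
  have N: "?N \<noteq> 0"
    using two_neq_0 of_nat_choose_neq_0[of "k - t" "n - t"] tk kn by simp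
  have RL: "restrict_sum n k t ?L = scale (of_nat l) (all_faces n t)"
    unfolding restrict_sum_lin restrict_sum_all_faces[OF tk kn] using N by simp
  \<comment> \<open>The spectral components of \<open>?L\<close>, concentrated at
    \<open>(0, 0)\<close> by \<open>all_faces_eig\<close>.\<close>
  define e where "e j i = (if j = 0 \<and> i = 0 then ?L else 0)" for j i :: nat
  have e00: "e 0 0 = ?L" unfolding e_def by simp
  have ej: "e j i = 0" if "(j, i) \<noteq> (0, 0)" for j i
    using that unfolding e_def by (intro if_not_P) simp
  have e: "e j i \<in> eig n k j i" for j i
  proof (cases "(j, i) = (0, 0)")
    case True
    then have "j = 0" "i = 0" by simp_all
    then show ?thesis
      using fvs.subspace_scale[OF subspace_eig all_faces_eig] by (simp only: e00)
  next
    case False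
    show ?thesis unfolding ej[OF False] by (rule fvs.subspace_0[OF subspace_eig])
  qed
  have se: "(\<Sum>j\<le>k. \<Sum>i\<le>min (k - j) (n - k). e j i) = ?L"
  proof -
    have "(\<Sum>i\<le>min (k - j) (n - k). e j i) = (if j = 0 then ?L else 0)" for j
      unfolding e_def by (cases "j = 0") simp_all
    then show ?thesis by simp
  qed
  have "is_design_mod CHAR('a) n t k l B \<longleftrightarrow> restrict_sum n k t (f - ?L) = 0"
    unfolding is_design_mod_iff[OF B f] restrict_sum_lin(2) RL by (simp only: right_minus_eq)
  also have "\<dots> \<longleftrightarrow> (\<forall>j\<le>t. \<forall>i\<le>min (t - j) (n - k). c j i - e j i = 0)"
  proof (rule restrict_sum_eq_0_iff[OF kn tk])
    show "c j i - e j i \<in> eig n k j i" if "j \<le> k" "i \<le> min (k - j) (n - k)" for j i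
      using comps(1) that e by (intro fvs.subspace_diff[OF subspace_eig]) blast+
    show "f - ?L = (\<Sum>j\<le>k. \<Sum>i\<le>min (k - j) (n - k). c j i - e j i)"
      using comps(2) se by (simp only: sum_subtractf)
  qed
  also have "\<dots> \<longleftrightarrow> c 0 0 = ?L \<and>
      (\<forall>j i. (j, i) \<noteq> (0, 0) \<and> j \<le> t \<and> i \<le> min (t - j) (n - k) \<longrightarrow> c j i = 0)"
    (is "?A \<longleftrightarrow> ?B")
  proof
    assume A: ?A
    have "c 0 0 = ?L" using A e00 by (metis right_minus_eq le0)
    moreover have "c j i = 0" if "(j, i) \<noteq> (0, 0) \<and> j \<le> t \<and> i \<le> min (t - j) (n - k)" for j i
      using A that ej[of j i] by (metis diff_zero)
    ultimately show ?B by blast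
  next
    assume C: ?B
    have "c j i = e j i" if "j \<le> t" "i \<le> min (t - j) (n - k)" for j i
      using C that e00 ej[of j i] by (cases "(j, i) = (0, 0)") (simp_all only: prod.inject, metis)
    then show ?A by (simp only: right_minus_eq) blast
  qed
  finally show ?thesis .
qed

text \<open>In positive characteristic the field sees the counts only modulo
  \<open>CHAR('a)\<close>, so the full equivalence is stated for designs modulo the characteristic.
  For exact designs it is stated when the characteristic is 0 or exceeds both \<open>l\<close> and
  the largest possible count, and the forward implication without such a bound.\<close>

theorem theorem3p4:
  fixes n t k l :: nat
    and B :: "vertex set set"
    and f :: "vertex set \<Rightarrow> 'a::field"
    and c :: "nat \<Rightarrow> nat \<Rightarrow> vertex set \<Rightarrow> 'a"
  assumes "CHAR('a) = 0 \<or> CHAR('a) > n"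
    and "CHAR('a) \<noteq> 2"
    and "0 < t" and "t \<le> k" and "k \<le> n"
    and "B \<subseteq> faces n k"
    and "f = (\<Sum>x\<in>B. basis x)"
    and "c = spectral_components n k f"
  shows "let spectral =
           (c 0 0 = scale (of_nat l / (2 ^ (k - t) * of_nat ((n - t) choose (k - t))))
                      (\<Sum>x\<in>faces n k. basis x) \<and>
            (\<forall>j i. (j, i) \<noteq> (0, 0) \<and> j \<le> t \<and> i \<le> min (t - j) (n - k) \<longrightarrow> c j i = 0))
         in
           (is_design n t k l B \<longrightarrow> spectral) \<and>
           (CHAR('a) = 0 \<or> (CHAR('a) > l \<and> CHAR('a) > 2 ^ (k - t) * ((n - t) choose (k - t)))
              \<longrightarrow> (is_design n t k l B \<longleftrightarrow> spectral)) \<and>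
           (is_design_mod CHAR('a) n t k l B \<longleftrightarrow> spectral)"
proof -
  interpret good_char n "TYPE('a)"
    using assms(1,2) by unfold_locales
  note iff = is_design_mod_iff_spectral[OF assms(4-8), of l, unfolded all_faces_def]
  show ?thesis
    \<comment> \<open>With the spectral condition folded back into \<open>is_design_mod\<close>,
      only the comparison of exact and modular designs is left.\<close>
    unfolding Let_def iff[symmetric]
    using is_design_imp_is_design_mod[of n t k l B "CHAR('a)"] is_design_mod_0[of n t k l B]
      is_design_iff_is_design_mod[OF assms(4,5), of l "CHAR('a)" B]
    by metis
qed

end
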